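(* For any integer $k \geq 2$, every $\left( \left\lceil \frac{\delta(G)^2}{\delta(G)-k} \right\rceil - 2 \right)$-connected line graph $L(G)$ has $k$ completely independent spanning trees if $G$ is super edge-connected and $k < \delta(G) < 2k$.
   Context: All graphs are finite, simple and undirected. $L(G)$ is the line graph of $G$ (vertex set $E(G)$, two vertices adjacent iff the corresponding edges share an endpoint). $\delta(G)$ is the minimum degree of $G$. A graph is $m$-connected if its (vertex) connectivity is at least $m$. An edge-cut of a connected graph is a set of edges whose removal disconnects it; a connected graph is super edge-connected if every minimum edge-cut isolates a vertex. Spanning trees $T_1,\dots,T_k$ of a graph $H$ are completely independent if for any two distinct vertices $u,v$ of $H$, the $u$–$v$ paths in $T_1,\dots,T_k$ are pairwise edge-disjoint and pairwise share no vertex other than $u$ and $v$. *)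

theory Defs
  imports Complex_Main
begin

record 'a graph =
  verts :: "'a set"
  edges :: "'a set set"

definition simple_graph :: "'a graph \<Rightarrow> bool" where
  "simple_graph G \<longleftrightarrow>
     finite (verts G) \<and> (\<forall>e\<in>edges G. e \<subseteq> verts G \<and> card e = 2)"

definition degree :: "'a graph \<Rightarrow> 'a \<Rightarrow> nat" where
  "degree G v = card {e \<in> edges G. v \<in> e}"

definition min_degree :: "'a graph \<Rightarrow> nat" where
  "min_degree G = Min (degree G ` verts G)"

definition line_graph :: "'a graph \<Rightarrow> 'a set graph" where
  "line_graph G =
     \<lparr>verts = edges G,
      edges = {{e, f} | e f. e \<in> edges G \<and> f \<in> edges G \<and> e \<noteq> f \<and> e \<inter> f \<noteq> {}}\<rparr>"

text \<open>A path is given by the list of its pairwise distinct vertices.\<close>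

definition path_edges :: "'a list \<Rightarrow> 'a set set" where
  "path_edges p = {{p ! i, p ! Suc i} | i. Suc i < length p}"

definition is_path :: "'a graph \<Rightarrow> 'a \<Rightarrow> 'a list \<Rightarrow> 'a \<Rightarrow> bool" where
  "is_path G u p v \<longleftrightarrow>
     p \<noteq> [] \<and> hd p = u \<and> last p = v \<and> distinct p \<and>
     set p \<subseteq> verts G \<and> path_edges p \<subseteq> edges G"

definition graph_connected :: "'a graph \<Rightarrow> bool" where
  "graph_connected G \<longleftrightarrow>
     verts G \<noteq> {} \<and> (\<forall>u\<in>verts G. \<forall>v\<in>verts G. \<exists>p. is_path G u p v)"

definition delete_verts :: "'a graph \<Rightarrow> 'a set \<Rightarrow> 'a graph" where
  "delete_verts G S = \<lparr>verts = verts G - S, edges = {e \<in> edges G. e \<inter> S = {}}\<rparr>"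

definition delete_edges :: "'a graph \<Rightarrow> 'a set set \<Rightarrow> 'a graph" where
  "delete_edges G F = \<lparr>verts = verts G, edges = edges G - F\<rparr>"

text \<open>Least number of vertices whose deletion leaves a disconnected graph or at most one
  vertex; the second alternative gives a complete graph on \<open>n\<close> vertices connectivity
  \<open>n - 1\<close>.\<close>

definition connectivity :: "'a graph \<Rightarrow> nat" where
  "connectivity G =
     (LEAST n. \<exists>S\<subseteq>verts G. card S = n \<and>
        (\<not> graph_connected (delete_verts G S) \<or> card (verts G - S) \<le> 1))"

definition m_connected :: "int \<Rightarrow> 'a graph \<Rightarrow> bool" where
  "m_connected m G \<longleftrightarrow> m \<le> int (connectivity G)"

definition edge_cut :: "'a graph \<Rightarrow> 'a set set \<Rightarrow> bool" where
  "edge_cut G F \<longleftrightarrow> F \<subseteq> edges G \<and> \<not> graph_connected (delete_edges G F)"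

definition minimum_edge_cut :: "'a graph \<Rightarrow> 'a set set \<Rightarrow> bool" where
  "minimum_edge_cut G F \<longleftrightarrow>
     edge_cut G F \<and> (\<forall>F'. edge_cut G F' \<longrightarrow> card F \<le> card F')"

definition super_edge_connected :: "'a graph \<Rightarrow> bool" where
  "super_edge_connected G \<longleftrightarrow>
     graph_connected G \<and>
     (\<forall>F. minimum_edge_cut G F \<longrightarrow> (\<exists>v\<in>verts G. degree (delete_edges G F) v = 0))"

definition acyclic_graph :: "'a graph \<Rightarrow> bool" where
  "acyclic_graph G \<longleftrightarrow>
     \<not> (\<exists>u p v. is_path G u p v \<and> length p \<ge> 3 \<and> {v, u} \<in> edges G)"

definition spanning_tree :: "'a graph \<Rightarrow> 'a graph \<Rightarrow> bool" where
  "spanning_tree T H \<longleftrightarrow>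
     verts T = verts H \<and> edges T \<subseteq> edges H \<and> graph_connected T \<and> acyclic_graph T"

text \<open>Since \<open>u\<close>-\<open>v\<close> paths in trees are unique, quantifying over all
  \<open>u\<close>-\<open>v\<close> paths of \<open>T i\<close> and \<open>T j\<close> refers to exactly one path in each.\<close>

definition completely_independent_spanning_trees ::
    "'a graph \<Rightarrow> nat \<Rightarrow> (nat \<Rightarrow> 'a graph) \<Rightarrow> bool" where
  "completely_independent_spanning_trees H k T \<longleftrightarrow>
     (\<forall>i<k. spanning_tree (T i) H) \<and>
     (\<forall>u\<in>verts H. \<forall>v\<in>verts H. u \<noteq> v \<longrightarrow>
        (\<forall>i<k. \<forall>j<k. i \<noteq> j \<longrightarrow>
          (\<forall>p q. is_path (T i) u p v \<longrightarrow> is_path (T j) u q v \<longrightarrow>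
             path_edges p \<inter> path_edges q = {} \<and> set p \<inter> set q = {u, v})))"

end

theory Submission
  imports Defs
begin

text \<open>Write \<open>\<delta>\<close> for the minimum degree of \<open>G\<close>. The edges adjacent to an edge \<open>uv\<close> separate it in the line
  graph, so \<open>d(u) + d(v) \<ge> \<delta>\<^sup>2 / (\<delta> - k)\<close>; together with \<open>d(u), d(v) \<ge> \<delta>\<close> this gives
  \<open>1 / d(u) + 1 / d(v) \<le> 1 / k\<close>. An edge cut of \<open>G\<close> with an edge on either side is a vertex cut of the
  line graph, so the same inequality survives contracting the parts of a partition of the vertices
  into \<open>p\<close> connected parts. Summing it over the crossing edges shows that there are at least
  \<open>k (p - 1)\<close> of them, and by the Nash-Williams--Tutte theorem \<open>E(G)\<close> splits into \<open>k\<close> spanning connected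
  classes. Each class induces a connected subgraph of the line graph. Between two classes \<open>A\<close>, \<open>B\<close>
  the elements can choose neighbours in the opposite class such that no two elements choose each
  other; attaching all elements outside \<open>A\<close> as leaves at the chosen elements of \<open>A\<close> yields the trees.\<close>

section \<open>Matroid union\<close>

text \<open>A matroid presented by its closure operator. \<open>cl\<close> acts on all sets of the
  type and may add elements outside \<open>E\<close> (\<open>edge_span\<close> always contains the
  empty set and the singletons), so exchange is demanded only inside \<open>E\<close>.\<close>

locale exchange_closure =
  fixes E :: "'e set" and cl :: "'e set \<Rightarrow> 'e set"
  assumes finite_E: "finite E"
    and cl_extensive: "A \<subseteq> cl A"
    and cl_mono: "A \<subseteq> B \<Longrightarrow> cl A \<subseteq> cl B"
    and cl_idem: "cl (cl A) = cl A"
    and cl_exchange: "A \<subseteq> E \<Longrightarrow> e \<in> E \<Longrightarrow> f \<in> E \<Longrightarrow> f \<in> cl (insert e A) \<Longrightarrow> f \<notin> cl A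
      \<Longrightarrow> e \<in> cl (insert f A)"
begin

definition indep :: "'e set \<Rightarrow> bool" where
  "indep A \<longleftrightarrow> A \<subseteq> E \<and> (\<forall>e\<in>A. e \<notin> cl (A - {e}))"

definition packing :: "nat \<Rightarrow> (nat \<Rightarrow> 'e set) \<Rightarrow> bool" where
  "packing k F \<longleftrightarrow> (\<forall>i<k. indep (F i)) \<and> (\<forall>i<k. \<forall>j<k. \<forall>e. e \<in> F i \<longrightarrow> e \<in> F j \<longrightarrow> i = j)"

text \<open>The condition \<open>e \<notin> cl (F' i - {f})\<close> keeps class \<open>i\<close>
  independent; when \<open>F' i\<close> spans \<open>e\<close>, it says that \<open>f\<close> lies
  on the circuit closed by \<open>e\<close>. In a packing, the step leaves \<open>f\<close>
  uncovered in turn.\<close>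

inductive swaps :: "nat \<Rightarrow> (nat \<Rightarrow> 'e set) \<Rightarrow> (nat \<Rightarrow> 'e set) \<Rightarrow> bool" for k F where
  refl: "swaps k F F"
| swap: "swaps k F F' \<Longrightarrow> i < k \<Longrightarrow> e \<in> E \<Longrightarrow> \<forall>j<k. e \<notin> F' j \<Longrightarrow> f \<in> F' i
    \<Longrightarrow> e \<notin> cl (F' i - {f}) \<Longrightarrow> swaps k F (F'(i := insert e (F' i - {f})))"

section \<open>Independent sets and fundamental circuits\<close>

lemma cl_subset: "A \<subseteq> cl B \<Longrightarrow> cl A \<subseteq> cl B"
  using cl_mono cl_idem by metis

text \<open>If \<open>f\<close> in \<open>A\<close> became dependent after adding \<open>e\<close>,
  exchange would put \<open>e\<close> into \<open>cl A\<close>.\<close>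

lemma indep_insert:
  assumes "indep A" "e \<in> E" "e \<notin> cl A"
  shows "indep (insert e A)"
  unfolding indep_def
proof (intro conjI ballI)
  show "insert e A \<subseteq> E" using assms by (auto simp: indep_def)
  have A: "A \<subseteq> E" and eA: "e \<notin> A" using assms cl_extensive by (auto simp: indep_def)
  fix f assume f: "f \<in> insert e A"
  show "f \<notin> cl (insert e A - {f})"
  proof (cases "f = e")
    case True
    then show ?thesis using assms eA by auto
  next
    case False
    show ?thesis
    proof
      assume "f \<in> cl (insert e A - {f})"
      then have "f \<in> cl (insert e (A - {f}))" using False by (simp add: insert_Diff_if)
      moreover have "f \<notin> cl (A - {f})" using assms f False by (auto simp: indep_def)
      ultimately have "e \<in> cl (insert f (A - {f}))"
        using cl_exchange[of "A - {f}" e f] A assms f by auto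
      then show False using assms f False by (simp add: insert_absorb)
    qed
  qed
qed

lemma indep_subset: "indep A \<Longrightarrow> B \<subseteq> A \<Longrightarrow> indep B"
  unfolding indep_def by (metis Diff_mono cl_mono order.refl order.trans subsetD)

text \<open>The set in the conclusion is the fundamental circuit of \<open>e\<close> without
  \<open>e\<close>. It contains every smallest \<open>C \<subseteq> A\<close> spanning
  \<open>e\<close>: if \<open>A - {f}\<close> still spanned \<open>e\<close> for some
  \<open>f\<close> in \<open>C\<close>, exchange and the minimality of \<open>C\<close> would put
  \<open>f\<close> into \<open>cl (A - {f})\<close>.\<close>

lemma fundamental_circuit:
  assumes "indep A" "e \<in> E" "e \<in> cl A"
  shows "e \<in> cl {f \<in> A. e \<notin> cl (A - {f})}"
proof -
  have finA: "finite A" using assms finite_E finite_subset by (auto simp: indep_def)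
  obtain C where C: "C \<subseteq> A" "e \<in> cl C" and min: "\<And>D. D \<subseteq> A \<Longrightarrow> e \<in> cl D \<Longrightarrow> card C \<le> card D"
    using ex_has_least_nat[of "\<lambda>D. D \<subseteq> A \<and> e \<in> cl D" A card] assms by auto
  have "e \<notin> cl (A - {f})" if f: "f \<in> C" for f
  proof
    assume e: "e \<in> cl (A - {f})"
    have "card (C - {f}) < card C"
      using f C finA finite_subset by (metis card_Diff1_less)
    then have "e \<notin> cl (C - {f})" using min[of "C - {f}"] C by auto
    then have "f \<in> cl (insert e (C - {f}))"
      using cl_exchange[of "C - {f}" f e] C f assms by (auto simp: insert_absorb indep_def)
    moreover have "insert e (C - {f}) \<subseteq> cl (A - {f})"
      using e C cl_extensive[of "A - {f}"] by auto
    ultimately have "f \<in> cl (A - {f})" using cl_subset by blast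
    then show False using assms f C by (auto simp: indep_def)
  qed
  then have "C \<subseteq> {f \<in> A. e \<notin> cl (A - {f})}" using C by auto
  then show ?thesis using C cl_mono by blast
qed

lemma swaps_packing:
  assumes "swaps k F F'" "packing k F"
  shows "packing k F' \<and> (\<Sum>i<k. card (F' i)) = (\<Sum>i<k. card (F i))"
  using assms
proof induction
  case (swap F' i e f)
  let ?F = "F'(i := insert e (F' i - {f}))"
  have pack: "packing k F'" and card: "(\<Sum>i<k. card (F' i)) = (\<Sum>i<k. card (F i))"
    using swap by auto
  have "indep (insert e (F' i - {f}))"
    using pack swap by (intro indep_insert) (auto simp: packing_def intro: indep_subset)
  then have "packing k ?F"
    using pack swap unfolding packing_def by (auto simp: fun_upd_def)
  moreover have "card (?F j) = card (F' j)" if "j < k" for j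
  proof (cases "j = i")
    case True
    have "finite (F' i)"
      using pack swap finite_E finite_subset by (auto simp: packing_def indep_def)
    then have "card (insert e (F' i - {f})) = Suc (card (F' i - {f}))"
      using swap by (intro card_insert_disjoint) auto
    then show ?thesis using True swap card_Suc_Diff1[OF \<open>finite (F' i)\<close> \<open>f \<in> F' i\<close>] by simp
  qed auto
  ultimately show ?case using card by (metis (no_types, lifting) lessThan_iff sum.cong)
qed auto

text \<open>The set \<open>R\<close> consists of all elements left uncovered by some packing that arises from \<open>F\<close>
  by a sequence of single exchanges. Working with a sequence of exchanges rather than with one
  augmenting path means that no shortest-path argument is needed: each exchange preserves the
  span of \<open>F i \<inter> R\<close>.\<close>

theorem maximum_packing_tight_set:
  assumes pack: "packing k F"
    and max: "\<And>F'. packing k F' \<Longrightarrow> (\<Sum>i<k. card (F' i)) \<le> (\<Sum>i<k. card (F i))"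
  obtains R where "R \<subseteq> E" "E - R \<subseteq> (\<Union>i<k. F i)" "\<And>i. i < k \<Longrightarrow> R \<subseteq> cl (F i \<inter> R)"
proof
  define R where "R = {e \<in> E. \<exists>F'. swaps k F F' \<and> (\<forall>j<k. e \<notin> F' j)}"
  show "R \<subseteq> E" by (auto simp: R_def)
  show "E - R \<subseteq> (\<Union>i<k. F i)" using swaps.refl by (auto simp: R_def)
  \<comment> \<open>Maximality forces \<open>e\<close> into \<open>cl (F' i)\<close>. Every
    \<open>f\<close> on the circuit of \<open>e\<close> can be swapped out for \<open>e\<close>, is
    then uncovered, and hence belongs to \<open>R\<close>.\<close>
  have circuit: "e \<in> cl (F' i \<inter> R)"
    if F': "swaps k F F'" and e: "e \<in> E" "\<forall>j<k. e \<notin> F' j" and i: "i < k" for F' e i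
  proof -
    have pack': "packing k F'" and sum': "(\<Sum>i<k. card (F' i)) = (\<Sum>i<k. card (F i))"
      using swaps_packing[OF F' pack] by auto
    have fin: "finite (F' i)"
      using pack' i finite_E finite_subset by (auto simp: packing_def indep_def)
    have "e \<in> cl (F' i)"
    proof (rule ccontr)
      assume "e \<notin> cl (F' i)"
      then have "indep (insert e (F' i))" using pack' i e indep_insert by (auto simp: packing_def)
      then have "packing k (F'(i := insert e (F' i)))"
        using pack' i e unfolding packing_def by (auto simp: fun_upd_def)
      then have "(\<Sum>j<k. card ((F'(i := insert e (F' i))) j)) \<le> (\<Sum>j<k. card (F' j))"
        using max sum' by metis
      moreover have "(\<Sum>j<k. card ((F'(i := insert e (F' i))) j)) > (\<Sum>j<k. card (F' j))"
        using i e fin by (intro sum_strict_mono_ex1) (auto simp: card_insert_if)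
      ultimately show False by linarith
    qed
    then have "e \<in> cl {f \<in> F' i. e \<notin> cl (F' i - {f})}"
      using fundamental_circuit pack' i e by (auto simp: packing_def)
    moreover have "{f \<in> F' i. e \<notin> cl (F' i - {f})} \<subseteq> F' i \<inter> R"
    proof safe
      fix f assume f: "f \<in> F' i" "e \<notin> cl (F' i - {f})"
      have "\<forall>j<k. f \<notin> (F'(i := insert e (F' i - {f}))) j"
        using pack' f i e unfolding packing_def by auto
      moreover have "f \<in> E" using pack' f i unfolding packing_def indep_def by auto
      ultimately show "f \<in> R"
        using swaps.swap[OF F' i e f] unfolding R_def by blast
    qed
    ultimately show ?thesis using cl_mono by blast
  qed
  \<comment> \<open>A swap trades \<open>f\<close> for \<open>e\<close>, both in \<open>R\<close>.
    Each is spanned by the other together with the rest of the class inside \<open>R\<close>, so the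
    closure does not change.\<close>
  have span: "cl (F' j \<inter> R) = cl (F j \<inter> R)" if "swaps k F F'" "j < k" for F' j
    using that
  proof (induction)
    case (swap F' i e f)
    show ?case
    proof (cases "j = i")
      case True
      let ?A = "F' i \<inter> R" and ?B = "insert e (F' i \<inter> R - {f})"
      have pack': "packing k F'" using swaps_packing swap pack by blast
      have FE: "F' i \<subseteq> E" using pack' swap by (auto simp: packing_def indep_def)
      have e: "e \<in> cl ?A" using circuit swap by blast
      have eR: "e \<in> R" using swap unfolding R_def by blast
      have "\<forall>j<k. f \<notin> (F'(i := insert e (F' i - {f}))) j"
        using pack' swap unfolding packing_def by auto
      then have fR: "f \<in> R"
        using swaps.swap[OF swap.hyps(1-6)] FE swap.hyps unfolding R_def by blast
      have "e \<notin> cl (?A - {f})" using swap cl_mono[of "?A - {f}" "F' i - {f}"] by auto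
      moreover have "insert f (?A - {f}) = ?A" using swap fR by auto
      ultimately have "f \<in> cl ?B"
        using cl_exchange[of "?A - {f}" f e] e FE swap by auto
      then have "?A \<subseteq> cl ?B" using cl_extensive[of ?B] by auto
      moreover have "?B \<subseteq> cl ?A" using e cl_extensive[of ?A] by auto
      ultimately have "cl ?A = cl ?B" using cl_subset by (simp add: subset_antisym)
      moreover have "(F'(i := insert e (F' i - {f}))) j \<inter> R = ?B" using True eR by auto
      ultimately show ?thesis using swap True by auto
    qed (use swap in auto)
  qed auto
  show "R \<subseteq> cl (F i \<inter> R)" if i: "i < k" for i
  proof
    fix e assume "e \<in> R"
    then obtain F' where "swaps k F F'" "e \<in> E" "\<forall>j<k. e \<notin> F' j" unfolding R_def by blast
    then show "e \<in> cl (F i \<inter> R)" using circuit span i by blast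
  qed
qed

end

section \<open>Connectivity by edge sets\<close>

text \<open>Reflexive on the whole type, so that it is an equivalence on \<open>UNIV\<close>. For
  edges inside \<open>V\<close>, the quotient \<open>V // conn A\<close> is the set of components of
  the graph on \<open>V\<close> with edge set \<open>A\<close>, isolated vertices included.\<close>

definition conn :: "'a set set \<Rightarrow> ('a \<times> 'a) set" where
  "conn A = {(x, y). \<exists>e\<in>A. x \<in> e \<and> y \<in> e}\<^sup>*"

text \<open>On two-element sets this is the closure operator of the graphic matroid.\<close>

definition edge_span :: "'a set set \<Rightarrow> 'a set set" where
  "edge_span A = {e. \<forall>x\<in>e. \<forall>y\<in>e. (x, y) \<in> conn A}"

lemma conn_refl [simp]: "(x, x) \<in> conn A"
  by (simp add: conn_def)

lemma conn_edge: "e \<in> A \<Longrightarrow> x \<in> e \<Longrightarrow> y \<in> e \<Longrightarrow> (x, y) \<in> conn A"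
  unfolding conn_def by blast

lemma conn_sym: "(x, y) \<in> conn A \<Longrightarrow> (y, x) \<in> conn A"
proof -
  have "sym {(x, y). \<exists>e\<in>A. x \<in> e \<and> y \<in> e}" by (auto simp: sym_def)
  then show "(x, y) \<in> conn A \<Longrightarrow> (y, x) \<in> conn A"
    unfolding conn_def by (meson sym_rtrancl symE)
qed

lemma conn_trans: "(x, y) \<in> conn A \<Longrightarrow> (y, z) \<in> conn A \<Longrightarrow> (x, z) \<in> conn A"
  unfolding conn_def by (rule rtrancl_trans)

lemma equiv_conn: "equiv UNIV (conn A)"
  by (intro equivI refl_onI symI transI) (simp_all, erule conn_sym, erule (1) conn_trans)

lemma conn_induct [consumes 1, case_names refl step]:
  assumes "(x, y) \<in> conn A" "P x"
    and "\<And>y z e. (x, y) \<in> conn A \<Longrightarrow> e \<in> A \<Longrightarrow> y \<in> e \<Longrightarrow> z \<in> e \<Longrightarrow> P y \<Longrightarrow> P z"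
  shows "P y"
  using assms(1)[unfolded conn_def]
proof (induction rule: rtrancl_induct)
  case (step y z)
  then show ?case using assms(3)[unfolded conn_def] by blast
qed (rule assms(2))

lemma conn_subset_edge_span:
  assumes "A \<subseteq> edge_span B"
  shows "conn A \<subseteq> conn B"
proof safe
  fix x y assume "(x, y) \<in> conn A"
  then show "(x, y) \<in> conn B"
  proof (induction rule: conn_induct)
    case (step y z e)
    then have "(y, z) \<in> conn B" using assms unfolding edge_span_def by blast
    with step.IH show ?case by (rule conn_trans)
  qed simp
qed

lemma edge_span_extensive: "A \<subseteq> edge_span A"
  unfolding edge_span_def by (auto intro: conn_edge)

lemma doubleton_in_edge_span [simp]: "{x, y} \<in> edge_span A \<longleftrightarrow> (x, y) \<in> conn A"
  unfolding edge_span_def using conn_sym[of x y A] by auto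

lemma conn_mono: "A \<subseteq> B \<Longrightarrow> conn A \<subseteq> conn B"
  using conn_subset_edge_span[of A B] edge_span_extensive[of B] by auto

text \<open>A walk using the new edge several times can be shortened to one that uses it at most
  once, in one of its two directions.\<close>

lemma conn_insert:
  assumes "(x, y) \<in> conn (insert {u, v} A)"
  shows "(x, y) \<in> conn A \<or> (x, u) \<in> conn A \<and> (v, y) \<in> conn A \<or> (x, v) \<in> conn A \<and> (u, y) \<in> conn A"
  using assms
proof (induction rule: conn_induct)
  case (step y z e)
  show ?case
  proof (cases "e = {u, v}")
    case True
    then have "y = u \<or> y = v" "z = u \<or> z = v" using step by auto
    then show ?thesis using step.IH by (metis conn_refl)
  next
    case False
    then have "(y, z) \<in> conn A" using step conn_edge by fastforce
    then show ?thesis using step.IH conn_trans[of _ y A z] by blast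
  qed
qed simp

text \<open>If the ends of \<open>f\<close> become joined only through \<open>e\<close>, then
  \<open>A\<close> joins them to the two different ends of \<open>e\<close>, and \<open>f\<close>
  closes the detour between these.\<close>

lemma edge_span_exchange:
  assumes "card e = 2" "card f = 2" "f \<in> edge_span (insert e A)" "f \<notin> edge_span A"
  shows "e \<in> edge_span (insert f A)"
proof -
  obtain u v where e: "e = {u, v}" using assms by (meson card_2_iff)
  obtain x y where f: "f = {x, y}" using assms by (meson card_2_iff)
  have "(x, y) \<notin> conn A" using assms f by simp
  moreover have "(x, y) \<in> conn (insert {u, v} A)" using assms e f by simp
  ultimately have "(x, u) \<in> conn A \<and> (v, y) \<in> conn A \<or> (x, v) \<in> conn A \<and> (u, y) \<in> conn A"
    using conn_insert[of x y u v A] by blast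
  moreover have "conn A \<subseteq> conn (insert f A)" by (rule conn_mono) auto
  moreover have "(x, y) \<in> conn (insert f A)" using f conn_edge[of f "insert f A" x y] by simp
  ultimately have "(u, v) \<in> conn (insert f A)" by (meson conn_sym conn_trans subsetD)
  then show ?thesis using e by simp
qed

lemma exchange_closure_edge_span:
  assumes "finite E" "\<And>e. e \<in> E \<Longrightarrow> card e = 2"
  shows "exchange_closure E edge_span"
proof
  show "edge_span A \<subseteq> edge_span B" if "A \<subseteq> B" for A B :: "'a set set"
    using conn_mono[OF that] unfolding edge_span_def by blast
  show "edge_span (edge_span A) = edge_span A" for A :: "'a set set"
    using conn_subset_edge_span[of "edge_span A" A] edge_span_extensive[of "edge_span A"]
    unfolding edge_span_def by blast
  show "e \<in> edge_span (insert f A)"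
    if "e \<in> E" "f \<in> E" "f \<in> edge_span (insert e A)" "f \<notin> edge_span A" for A e f
    using that assms edge_span_exchange by metis
qed (rule assms(1), rule edge_span_extensive)

section \<open>Components of a forest\<close>

lemma conn_class_eq_iff: "conn A `` {x} = conn A `` {y} \<longleftrightarrow> (x, y) \<in> conn A"
  using eq_equiv_class_iff[OF equiv_conn UNIV_I UNIV_I] .

text \<open>Induction on the edges: each new edge of a forest merges exactly two components.\<close>

lemma card_forest_components:
  assumes V: "finite V" and A: "finite A" "\<And>e. e \<in> A \<Longrightarrow> e \<subseteq> V \<and> card e = 2"
    and forest: "\<And>e. e \<in> A \<Longrightarrow> e \<notin> edge_span (A - {e})"
  shows "card A + card (V // conn A) = card V"
  using A forest
proof (induction A rule: finite_induct)
  case empty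
  have "conn {} = (Id :: ('a \<times> 'a) set)" by (simp add: conn_def)
  then have "V // conn {} = (\<lambda>x. {x}) ` V" unfolding quotient_def by auto
  moreover have "inj_on (\<lambda>x. {x}) V" by (simp add: inj_on_def)
  ultimately show ?case by (simp add: card_image)
next
  case (insert e A)
  have e2: "e \<subseteq> V" "card e = 2" using insert.prems(1)[of e] by auto
  then obtain u v where e: "e = {u, v}" by (meson card_2_iff)
  have uv: "u \<in> V" "v \<in> V" using e2 e by auto
  have "e \<notin> edge_span A" using insert.prems(2)[of e] insert.hyps by simp
  then have nuv: "(u, v) \<notin> conn A" using e by simp
  have mono: "conn A \<subseteq> conn (insert e A)" by (rule conn_mono) auto
  have e': "(u, v) \<in> conn (insert e A)" using e conn_edge[of e "insert e A" u v] by simp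
  let ?a = "conn A `` {u}" and ?b = "conn A `` {v}"
  have new: "conn (insert e A) `` {x} = (if x \<in> ?a \<union> ?b then ?a \<union> ?b else conn A `` {x})" for x
  proof -
    have *: "(x, y) \<in> conn (insert e A) \<longleftrightarrow>
      (x, y) \<in> conn A \<or> (x, u) \<in> conn A \<and> (v, y) \<in> conn A \<or> (x, v) \<in> conn A \<and> (u, y) \<in> conn A" for y
    proof
      show "(x, y) \<in> conn A \<or> (x, u) \<in> conn A \<and> (v, y) \<in> conn A \<or> (x, v) \<in> conn A \<and> (u, y) \<in> conn A"
        if "(x, y) \<in> conn (insert e A)" using conn_insert that e by simp
      show "(x, y) \<in> conn (insert e A)"
        if "(x, y) \<in> conn A \<or> (x, u) \<in> conn A \<and> (v, y) \<in> conn A \<or> (x, v) \<in> conn A \<and> (u, y) \<in> conn A"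
        using that mono e' conn_sym[OF e'] by (elim disjE conjE) (meson conn_trans subsetD)+
    qed
    show ?thesis
    proof (cases "x \<in> ?a \<union> ?b")
      case True
      then have "(x, u) \<in> conn A \<or> (x, v) \<in> conn A" by (auto dest: conn_sym)
      then have "(x, y) \<in> conn (insert e A) \<longleftrightarrow> y \<in> ?a \<union> ?b" for y
        using * conn_trans[of u x A y] conn_trans[of v x A y] conn_trans[of x u A y]
          conn_trans[of x v A y] conn_sym by (metis Image_singleton_iff Un_iff)
      then show ?thesis using True by auto
    next
      case False
      then show ?thesis using * by (auto dest: conn_sym)
    qed
  qed
  have ab: "?a \<noteq> ?b" "?a \<in> V // conn A" "?b \<in> V // conn A"
    using nuv uv conn_class_eq_iff by (fastforce simp: quotient_def)+
  have disj: "C \<inter> D = {}" if "C \<in> V // conn A" "D \<in> V // conn A" "C \<noteq> D" for C D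
    using that quotient_disj[OF equiv_conn, of C A D] by (auto simp: quotient_def)
  have quot: "V // conn (insert e A) = insert (?a \<union> ?b) (V // conn A - {?a, ?b})"
  proof
    show "V // conn (insert e A) \<subseteq> insert (?a \<union> ?b) (V // conn A - {?a, ?b})"
    proof
      fix C assume "C \<in> V // conn (insert e A)"
      then obtain x where x: "x \<in> V" "C = conn (insert e A) `` {x}" by (auto simp: quotient_def)
      show "C \<in> insert (?a \<union> ?b) (V // conn A - {?a, ?b})"
      proof (cases "x \<in> ?a \<union> ?b")
        case True
        then show ?thesis using x new[of x] by simp
      next
        case False
        then have "conn A `` {x} \<noteq> ?a" "conn A `` {x} \<noteq> ?b"
          using conn_class_eq_iff[of A] conn_sym[of x _ A] by auto
        moreover have "conn A `` {x} \<in> V // conn A" using x by (auto simp: quotient_def)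
        ultimately show ?thesis using x new[of x] False by auto
      qed
    qed
    show "insert (?a \<union> ?b) (V // conn A - {?a, ?b}) \<subseteq> V // conn (insert e A)"
    proof
      fix C assume "C \<in> insert (?a \<union> ?b) (V // conn A - {?a, ?b})"
      then consider "C = ?a \<union> ?b" | "C \<in> V // conn A" "C \<noteq> ?a" "C \<noteq> ?b" by blast
      then show "C \<in> V // conn (insert e A)"
      proof cases
        case 1
        then show ?thesis using new[of u] uv by (auto simp: quotient_def)
      next
        case C: 2
        then obtain x where x: "x \<in> V" "C = conn A `` {x}" by (auto simp: quotient_def)
        then have "(u, x) \<notin> conn A" "(v, x) \<notin> conn A" using C conn_class_eq_iff[of A] by metis+
        then have "x \<notin> ?a \<union> ?b" by simp
        then show ?thesis using new[of x] x by (auto simp: quotient_def)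
      qed
    qed
  qed
  have fin: "finite (V // conn A)" using V by (simp add: quotient_def)
  \<comment> \<open>The merged class meets \<open>?a\<close>, so it is not one of the surviving
    classes, and the count drops by exactly one.\<close>
  have "?a \<union> ?b \<notin> V // conn A - {?a, ?b}"
  proof
    assume C: "?a \<union> ?b \<in> V // conn A - {?a, ?b}"
    then have "(?a \<union> ?b) \<inter> ?a = {}" using disj[of "?a \<union> ?b" ?a] ab by blast
    moreover have "u \<in> ?a" by simp
    ultimately show False by blast
  qed
  moreover have "card (V // conn A - {?a, ?b}) = card (V // conn A) - 2"
    using ab by (simp add: card_Diff_subset)
  moreover have "card {?a, ?b} \<le> card (V // conn A)" using ab fin by (intro card_mono) auto
  moreover have "card {?a, ?b} = 2" using ab by simp
  ultimately have "card (V // conn (insert e A)) + 1 = card (V // conn A)"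
    using fin quot by simp
  moreover have "card A + card (V // conn A) = card V"
  proof (rule insert.IH)
    fix f assume f: "f \<in> A"
    then show "f \<subseteq> V \<and> card f = 2" using insert.prems(1)[of f] by blast
    have "edge_span (A - {f}) \<subseteq> edge_span (insert e A - {f})"
      using conn_mono[of "A - {f}" "insert e A - {f}"] unfolding edge_span_def by blast
    then show "f \<notin> edge_span (A - {f})" using insert.prems(2)[of f] f by blast
  qed
  ultimately show ?case using insert.hyps by simp
qed

section \<open>Edge-disjoint spanning connected subgraphs\<close>

text \<open>Take \<open>k\<close> disjoint forests of maximal total size and their tight set
  \<open>R\<close>, whose span has \<open>p\<close> components on \<open>n\<close> vertices. Each
  forest has \<open>n - p\<close> edges in \<open>R\<close>. The forests cover all of
  \<open>E - R\<close>, hence at least \<open>k (p - 1)\<close> further edges by the hypothesis. The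
  total reaches \<open>k (n - 1)\<close>, so every forest is a spanning tree. Only partitions into
  components of edge sets are tested.\<close>

theorem Nash_Williams_Tutte:
  assumes V: "finite V" "V \<noteq> {}" and E: "\<And>e. e \<in> E \<Longrightarrow> e \<subseteq> V \<and> card e = 2"
    and cond: "\<And>R. R \<subseteq> E \<Longrightarrow> k * (card (V // conn R) - 1) \<le> card (E - edge_span R)"
  obtains F where "\<And>i. i < k \<Longrightarrow> F i \<subseteq> E" "\<And>i. i < k \<Longrightarrow> V \<times> V \<subseteq> conn (F i)"
    "\<And>i j e. i < k \<Longrightarrow> j < k \<Longrightarrow> e \<in> F i \<Longrightarrow> e \<in> F j \<Longrightarrow> i = j"
proof -
  have finE: "finite E" using V E by (intro finite_subset[of E "Pow V"]) auto
  interpret exchange_closure E edge_span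
    using exchange_closure_edge_span finE E by blast
  have bound: "(\<Sum>i<k. card (F i)) < Suc (k * card E)" if "packing k F" for F
  proof -
    have "card (F i) \<le> card E" if "i < k" for i
      using \<open>packing k F\<close> that finE by (auto simp: packing_def indep_def intro: card_mono)
    then show ?thesis using sum_bounded_above[of "{..<k}" "\<lambda>i. card (F i)" "card E"] by simp
  qed
  have "packing k (\<lambda>_. {})" by (simp add: packing_def indep_def)
  then obtain F where F: "packing k F"
    and max: "\<And>F'. packing k F' \<Longrightarrow> (\<Sum>i<k. card (F' i)) \<le> (\<Sum>i<k. card (F i))"
    using ex_has_greatest_nat[of "packing k" "\<lambda>_. {}" "\<lambda>F. \<Sum>i<k. card (F i)" "Suc (k * card E)"]
      bound by blast
  obtain R where R: "R \<subseteq> E" "E - R \<subseteq> (\<Union>i<k. F i)" "\<And>i. i < k \<Longrightarrow> R \<subseteq> edge_span (F i \<inter> R)"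
    using maximum_packing_tight_set[OF F max] by blast
  let ?n = "card V" and ?p = "card (V // conn R)"
  have FE: "F i \<subseteq> E" if "i < k" for i using F that by (auto simp: packing_def indep_def)
  have finF: "finite (F i)" if "i < k" for i using FE[OF that] finE finite_subset by blast
  have forest: "card A + card (V // conn A) = ?n" if "indep A" for A
    using that finE V E finite_subset
    by (intro card_forest_components) (auto simp: indep_def)
  have quot_pos: "card (V // conn A) \<ge> 1" for A
    using V by (simp add: quotient_def Suc_le_eq card_gt_0_iff)
  have inter: "card (F i \<inter> R) + ?p = ?n" if "i < k" for i
  proof -
    have "conn (F i \<inter> R) = conn R"
      using conn_subset_edge_span[OF R(3)[OF that]] conn_mono[of "F i \<inter> R" R] by auto
    moreover have "indep (F i \<inter> R)" using F that indep_subset[of "F i"] by (auto simp: packing_def)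
    ultimately show ?thesis using forest by metis
  qed
  have "E - edge_span R \<subseteq> (\<Union>i<k. F i - R)"
  proof
    fix e assume e: "e \<in> E - edge_span R"
    then have "e \<notin> R" using edge_span_extensive[of R] by (meson DiffD2 subsetD)
    moreover obtain i where "i < k" "e \<in> F i" using R(2) e \<open>e \<notin> R\<close> by (auto dest!: subsetD)
    ultimately show "e \<in> (\<Union>i<k. F i - R)" by auto
  qed
  then have "card (E - edge_span R) \<le> card (\<Union>i<k. F i - R)"
    using finF by (intro card_mono) auto
  also have "\<dots> \<le> (\<Sum>i<k. card (F i - R))" by (rule card_UN_le) simp
  finally have "k * (?p - 1) \<le> (\<Sum>i<k. card (F i - R))" using cond[OF R(1)] by linarith
  moreover have "(\<Sum>i<k. card (F i \<inter> R)) = k * (?n - ?p)"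
  proof -
    have "card (F i \<inter> R) = ?n - ?p" if "i < k" for i using inter[OF that] by simp
    then show ?thesis by simp
  qed
  moreover have "(\<Sum>i<k. card (F i)) = (\<Sum>i<k. card (F i - R)) + (\<Sum>i<k. card (F i \<inter> R))"
  proof -
    have "card (F i) = card (F i - R) + card (F i \<inter> R)" if "i < k" for i
      using card_Int_Diff[of "F i" R] finF[OF that] by simp
    then show ?thesis by (simp add: sum.distrib)
  qed
  \<comment> \<open>The truncated subtractions are exact because \<open>1 \<le> ?p \<le> ?n\<close>;
    the second bound comes from some forest and so needs \<open>0 < k\<close>.\<close>
  moreover have "k * (?p - 1) + k * (?n - ?p) = k * (?n - 1)" if "0 < k"
  proof -
    have "?p \<le> ?n" using inter[OF that] by simp
    then show ?thesis using quot_pos[of R] by (simp add: add_mult_distrib2[symmetric])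
  qed
  ultimately have total: "k * (?n - 1) \<le> (\<Sum>i<k. card (F i))" by (cases "k = 0") auto
  have le: "card (F i) \<le> ?n - 1" if "i < k" for i
    using forest[of "F i"] quot_pos[of "F i"] F that by (auto simp: packing_def)
  have eq: "card (F i) = ?n - 1" if i: "i < k" for i
  proof (rule ccontr)
    assume "card (F i) \<noteq> ?n - 1"
    then have "(\<Sum>i<k. card (F i)) < (\<Sum>i<k. ?n - 1)"
      using le i by (intro sum_strict_mono_ex1) (auto intro!: bexI[of _ i] simp: le_neq_implies_less)
    then show False using total by simp
  qed
  have "V \<times> V \<subseteq> conn (F i)" if i: "i < k" for i
  proof -
    have "card (V // conn (F i)) = 1"
      using forest[of "F i"] eq[OF i] F i V card_gt_0_iff[of V] by (auto simp: packing_def)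
    then obtain Q where Q: "V // conn (F i) = {Q}" by (meson card_1_singletonE)
    then have Q_eq: "conn (F i) `` {x} = Q" if "x \<in> V" for x
      using quotientI[OF that, of "conn (F i)"] by simp
    show ?thesis
    proof clarify
      fix x y assume "x \<in> V" "y \<in> V"
      then have "conn (F i) `` {x} = conn (F i) `` {y}" using Q_eq by simp
      then show "(x, y) \<in> conn (F i)" by (simp only: conn_class_eq_iff)
    qed
  qed
  moreover have "i = j" if "i < k" "j < k" "e \<in> F i" "e \<in> F j" for i j e
    using F that unfolding packing_def by metis
  ultimately show thesis using that[of F] FE by presburger
qed

section \<open>Trees given by parent functions\<close>

text \<open>Breadth-first search: \<open>rank\<close> is the distance to the root along
  \<open>r\<close>, and the parent is the next element on a shortest route.\<close>

lemma parent_function: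
  assumes "\<And>x. x \<in> X \<Longrightarrow> (x, rt) \<in> r\<^sup>*"
  obtains par :: "'b \<Rightarrow> 'b" and rank :: "'b \<Rightarrow> nat"
  where "\<And>x. x \<in> X \<Longrightarrow> x \<noteq> rt \<Longrightarrow> (x, par x) \<in> r \<and> rank (par x) < rank x"
proof -
  define rank where "rank x = (LEAST n. (x, rt) \<in> r ^^ n)" for x
  have "\<exists>y. (x, y) \<in> r \<and> rank y < rank x" if x: "x \<in> X" "x \<noteq> rt" for x
  proof -
    have "\<exists>n. (x, rt) \<in> r ^^ n" using assms[OF x(1)] rtrancl_imp_relpow by fast
    then have n: "(x, rt) \<in> r ^^ rank x" unfolding rank_def by (rule LeastI_ex)
    then obtain m where m: "rank x = Suc m" using x(2) by (cases "rank x") auto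
    then obtain y where y: "(x, y) \<in> r" "(y, rt) \<in> r ^^ m" using n relpow_Suc_D2 by metis
    then have "rank y \<le> m" unfolding rank_def by (intro Least_le)
    then show ?thesis using y m by auto
  qed
  then obtain par where "\<And>x. x \<in> X \<Longrightarrow> x \<noteq> rt \<Longrightarrow> (x, par x) \<in> r \<and> rank (par x) < rank x"
    by metis
  then show thesis by (rule that)
qed

section \<open>Paths with distinct vertices\<close>

lemma path_edges_append_subset: "path_edges p \<subseteq> path_edges (p @ q)"
proof
  fix e assume "e \<in> path_edges p"
  then obtain i where i: "Suc i < length p" "e = {p ! i, p ! Suc i}" unfolding path_edges_def by auto
  then have "e = {(p @ q) ! i, (p @ q) ! Suc i}" by (simp add: nth_append)
  then show "e \<in> path_edges (p @ q)" using i(1) unfolding path_edges_def by fastforce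
qed

lemma path_edges_snoc_subset:
  assumes "p \<noteq> []"
  shows "path_edges (p @ [w]) \<subseteq> insert {last p, w} (path_edges p)"
proof
  fix e assume "e \<in> path_edges (p @ [w])"
  then obtain i where i: "i < length p" "e = {(p @ [w]) ! i, (p @ [w]) ! Suc i}"
    unfolding path_edges_def by auto
  show "e \<in> insert {last p, w} (path_edges p)"
  proof (cases "Suc i = length p")
    case True
    then have "p ! i = last p" using last_conv_nth[OF assms] by (metis diff_Suc_1)
    moreover have "(p @ [w]) ! Suc i = w" using True by simp
    moreover have "(p @ [w]) ! i = p ! i" using i(1) by (simp add: nth_append)
    ultimately show ?thesis using i(2) by simp
  next
    case False
    then have "e = {p ! i, p ! Suc i}" "Suc i < length p" using i by (auto simp: nth_append)
    then show ?thesis unfolding path_edges_def by blast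
  qed
qed

text \<open>If \<open>w\<close> already lies on the path, cut the path there; otherwise append
  \<open>w\<close>. This keeps the vertices distinct.\<close>

lemma is_path_extend:
  assumes p: "is_path G u p v" and w: "{v, w} \<in> edges G" "w \<in> verts G"
  shows "\<exists>q. is_path G u q w"
proof (cases "w \<in> set p")
  case True
  then obtain a b where ab: "p = (a @ [w]) @ b" by (metis append.assoc append_Cons append_Nil split_list)
  then have "is_path G u (a @ [w]) w"
    using p path_edges_append_subset[of "a @ [w]" b] unfolding is_path_def
    by (auto simp: hd_append split: if_splits)
  then show ?thesis by blast
next
  case False
  then have "is_path G u (p @ [w]) w"
    using p w path_edges_snoc_subset[of p w] unfolding is_path_def by auto
  then show ?thesis by blast
qed

lemma is_path_rtrancl:
  assumes "(u, v) \<in> {(x, y). {x, y} \<in> edges G \<and> y \<in> verts G}\<^sup>*" "u \<in> verts G"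
  shows "\<exists>p. is_path G u p v"
  using assms
proof (induction rule: rtrancl_induct)
  case base
  have "is_path G u [u] u" using base by (auto simp: is_path_def path_edges_def)
  then show ?case by blast
next
  case (step y z)
  then show ?case using is_path_extend by fastforce
qed

text \<open>Predecessor and successor on the path differ. This excludes leaves of a tree from the
  interior of its paths.\<close>

lemma is_path_interior:
  assumes p: "is_path G u p v" and x: "x \<in> set p" "x \<noteq> u" "x \<noteq> v"
  obtains y z where "y \<noteq> z" "{x, y} \<in> edges G" "{x, z} \<in> edges G"
proof -
  obtain i where i: "i < length p" "x = p ! i" using x by (metis in_set_conv_nth)
  have p': "p \<noteq> []" "p ! 0 = u" "p ! (length p - 1) = v" "distinct p" "path_edges p \<subseteq> edges G"
    using p by (auto simp: is_path_def hd_conv_nth last_conv_nth)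
  have "i \<noteq> 0" "i \<noteq> length p - 1" using x i p' by metis+
  then have i': "0 < i" "Suc i < length p" using i by auto
  have "{p ! i, p ! Suc i} \<in> path_edges p" using i' unfolding path_edges_def by auto
  moreover have "{p ! (i - 1), p ! Suc (i - 1)} \<in> path_edges p"
    using i' unfolding path_edges_def by (intro CollectI exI[of _ "i - 1"]) auto
  moreover have "p ! Suc i \<noteq> p ! (i - 1)" using i' p' by (auto simp: nth_eq_iff_index_eq)
  ultimately show thesis using that[of "p ! Suc i" "p ! (i - 1)"] p' i i' by (auto simp: insert_commute)
qed

section \<open>The tree of a parent function\<close>

definition parent_graph :: "'b set \<Rightarrow> 'b \<Rightarrow> ('b \<Rightarrow> 'b) \<Rightarrow> 'b graph" where
  "parent_graph X rt par = \<lparr>verts = X, edges = {{x, par x} | x. x \<in> X \<and> x \<noteq> rt}\<rparr>"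

text \<open>Going from a vertex to its parent lowers the rank, so the climb ends at the
  root.\<close>

lemma parent_graph_connected:
  fixes rank :: "'b \<Rightarrow> nat"
  assumes rt: "rt \<in> X"
    and par: "\<And>x. x \<in> X \<Longrightarrow> x \<noteq> rt \<Longrightarrow> par x \<in> X \<and> rank (par x) < rank x"
  shows "graph_connected (parent_graph X rt par)"
proof -
  let ?T = "parent_graph X rt par"
  let ?r = "{(x, y). {x, y} \<in> edges ?T \<and> y \<in> verts ?T}"
  have up: "(x, rt) \<in> ?r\<^sup>* \<and> (rt, x) \<in> ?r\<^sup>*" if "x \<in> X" for x
    using that
  proof (induction "rank x" arbitrary: x rule: less_induct)
    case less
    show ?case
    proof (cases "x = rt")
      case False
      then have 1: "par x \<in> X" "rank (par x) < rank x" using par less.prems by auto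
      have "{x, par x} \<in> edges ?T" using less.prems False unfolding parent_graph_def by auto
      then have "(x, par x) \<in> ?r" "(par x, x) \<in> ?r"
        using 1 less.prems by (auto simp: parent_graph_def insert_commute)
      then show ?thesis using less.hyps[OF 1(2,1)]
        by (meson converse_rtrancl_into_rtrancl rtrancl.rtrancl_into_rtrancl)
    qed simp
  qed
  have "\<exists>p. is_path ?T u p v" if "u \<in> X" "v \<in> X" for u v
  proof (rule is_path_rtrancl)
    show "(u, v) \<in> ?r\<^sup>*" using up[OF that(1)] up[OF that(2)] by (meson rtrancl_trans)
    show "u \<in> verts ?T" using that by (simp add: parent_graph_def)
  qed
  then show ?thesis using rt unfolding graph_connected_def by (auto simp: parent_graph_def)
qed

text \<open>On a cycle, a vertex of maximal rank would have its parent as both of its neighbours.\<close>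

lemma parent_graph_acyclic:
  fixes rank :: "'b \<Rightarrow> nat"
  assumes par: "\<And>x. x \<in> X \<Longrightarrow> x \<noteq> rt \<Longrightarrow> rank (par x) < rank x"
  shows "acyclic_graph (parent_graph X rt par)"
  unfolding acyclic_graph_def
proof safe
  let ?T = "parent_graph X rt par"
  fix u p v assume p: "is_path ?T u p v" and len: "3 \<le> length p" and vu: "{v, u} \<in> edges ?T"
  have edge: "y = par x" if "{x, y} \<in> edges ?T" "rank y \<le> rank x" for x y
    using that par unfolding parent_graph_def by (fastforce simp: doubleton_eq_iff)
  have p': "p \<noteq> []" "p ! 0 = u" "p ! (length p - 1) = v" "distinct p" "path_edges p \<subseteq> edges ?T"
    using p by (auto simp: is_path_def hd_conv_nth last_conv_nth)
  obtain i where i: "i < length p" and max: "\<And>j. j < length p \<Longrightarrow> rank (p ! j) \<le> rank (p ! i)"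
    using ex_has_greatest_nat[of "\<lambda>j. j < length p" 0 "\<lambda>j. rank (p ! j)" "Suc (Max (rank ` set p))"] p'
    by (auto simp: less_Suc_eq_le)
  let ?n = "length p"
  \<comment> \<open>\<open>a\<close> and \<open>b\<close> are the cyclic neighbours of
    \<open>i\<close>, the edge \<open>{v, u}\<close> closing the cycle. They differ because the
    cycle has at least three vertices.\<close>
  define a where "a = (if i = 0 then ?n - 1 else i - 1)"
  define b where "b = (if i = ?n - 1 then 0 else i + 1)"
  have step: "{p ! j, p ! Suc j} \<in> edges ?T" if "Suc j < ?n" for j
    using that p' unfolding path_edges_def by auto
  have ab: "a < ?n" "b < ?n" "a \<noteq> b" using i len unfolding a_def b_def by auto
  have "{p ! i, p ! a} \<in> edges ?T"
    using step[of "i - 1"] i vu p' unfolding a_def by (auto simp: insert_commute)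
  moreover have "{p ! i, p ! b} \<in> edges ?T"
    using step[of i] i vu p' unfolding b_def by auto
  ultimately have "p ! a = p ! b" using edge max ab by metis
  then show False using ab p' by (simp add: nth_eq_iff_index_eq)
qed

section \<open>Completely independent spanning trees of a line graph\<close>

text \<open>Transfers connectedness from vertices to edges: follow a walk in \<open>A\<close> and
  change from one edge to the next at their common vertex by \<open>star\<close>. The relation
  \<open>r\<close> is left open, since it is adjacency inside one class in one use and incidence
  between two classes in the other.\<close>

lemma incident_edges_connected:
  assumes star: "\<And>x g h. x \<in> W \<Longrightarrow> g \<in> C \<Longrightarrow> h \<in> C \<Longrightarrow> x \<in> g \<Longrightarrow> x \<in> h \<Longrightarrow> (g, h) \<in> r\<^sup>*"
    and A: "A \<subseteq> C" "\<And>a. a \<in> A \<Longrightarrow> a \<subseteq> W"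
    and xy: "(x, y) \<in> conn A" "x \<in> W" "g \<in> C" "x \<in> g" "h \<in> C" "y \<in> h"
  shows "(g, h) \<in> r\<^sup>*"
proof -
  have "\<forall>h\<in>C. y \<in> h \<longrightarrow> (g, h) \<in> r\<^sup>*"
    using xy(1)
  proof (induction rule: conn_induct)
    case refl
    then show ?case using star xy by blast
  next
    case (step y z a)
    have "(g, a) \<in> r\<^sup>*" using step A by blast
    moreover have "(a, h) \<in> r\<^sup>*" if "h \<in> C" "z \<in> h" for h
      using star[of z a h] that step A by blast
    ultimately show ?case using rtrancl_trans by metis
  qed
  then show ?thesis using xy by blast
qed

lemma conn_incident_edge:
  assumes "card V \<ge> 2" "V \<times> V \<subseteq> conn A" "x \<in> V"
  obtains a where "a \<in> A" "x \<in> a"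
proof -
  have "\<not> V \<subseteq> {x}"
    using assms(1) card_mono[of "{x}" V] by auto
  then obtain y where y: "y \<in> V" "y \<noteq> x" by blast
  then have "(x, y) \<in> conn A" using assms by blast
  then show thesis unfolding conn_def
    by (rule converse_rtranclE) (use y that in auto)
qed

section \<open>Choosing neighbours between two classes\<close>

lemma card_2_eq_doubleton: "card e = 2 \<Longrightarrow> x \<in> e \<Longrightarrow> y \<in> e \<Longrightarrow> x \<noteq> y \<Longrightarrow> e = {x, y}"
  by (auto simp: card_2_iff)

text \<open>A vertex \<open>v\<close> farthest from a fixed root \<open>z\<close> is nobody's parent
  in the search tree, so the other vertices still reach \<open>z\<close> without it.\<close>

lemma non_cut_vertex:
  assumes V: "finite V" "card V \<ge> 2" and A: "\<And>e. e \<in> A \<Longrightarrow> e \<subseteq> V \<and> card e = 2"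
    and span: "V \<times> V \<subseteq> conn A"
  obtains v where "v \<in> V" "\<And>x y. x \<in> V - {v} \<Longrightarrow> y \<in> V - {v} \<Longrightarrow> (x, y) \<in> conn {a \<in> A. v \<notin> a}"
proof -
  obtain z where z: "z \<in> V" using V by fastforce
  have reach: "(x, z) \<in> {(x, y). \<exists>e\<in>A. x \<in> e \<and> y \<in> e}\<^sup>*" if "x \<in> V" for x
    using span that z unfolding conn_def by blast
  obtain par and rank :: "'a \<Rightarrow> nat" where par: "\<And>x. x \<in> V \<Longrightarrow> x \<noteq> z \<Longrightarrow>
      (x, par x) \<in> {(x, y). \<exists>e\<in>A. x \<in> e \<and> y \<in> e} \<and> rank (par x) < rank x"
    using parent_function[OF reach] by blast
  have "V - {z} \<noteq> {}" using V card_mono[of "{z}" V] by auto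
  then have "Max (rank ` (V - {z})) \<in> rank ` (V - {z})" using V by (intro Max_in) auto
  then obtain v where v: "v \<in> V - {z}" "Max (rank ` (V - {z})) = rank v" by blast
  have max: "rank x \<le> rank v" if "x \<in> V" "x \<noteq> z" for x
    using Max_ge[of "rank ` (V - {z})" "rank x"] that V v(2) by simp
  let ?A = "{a \<in> A. v \<notin> a}"
  have to_z: "(x, z) \<in> conn ?A" if "x \<in> V" "x \<noteq> v" for x
    using that
  proof (induction "rank x" arbitrary: x rule: less_induct)
    case less
    show ?case
    proof (cases "x = z")
      case False
      then obtain e where e: "e \<in> A" "x \<in> e" "par x \<in> e" and lt: "rank (par x) < rank x"
        using par less.prems by blast
      have pv: "par x \<noteq> v" using lt max[of x] less.prems False by auto
      have "card e = 2" "par x \<noteq> x" using A e lt by auto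
      then have "e = {x, par x}" using e by (intro card_2_eq_doubleton) auto
      then have "e \<in> ?A" using e pv less.prems by auto
      then have "(x, par x) \<in> conn ?A" using e conn_edge by metis
      moreover have "(par x, z) \<in> conn ?A" using less.hyps[OF lt] A e pv by blast
      ultimately show ?thesis by (rule conn_trans)
    qed simp
  qed
  show thesis
  proof (rule that)
    show "v \<in> V" using v by blast
  next
    fix x y assume "x \<in> V - {v}" "y \<in> V - {v}"
    then have "(x, z) \<in> conn ?A" "(z, y) \<in> conn ?A" using to_z conn_sym[OF to_z] by auto
    then show "(x, y) \<in> conn ?A" by (rule conn_trans)
  qed
qed

text \<open>In the bipartite graph of incidences between \<open>A\<close> and \<open>B\<close>, some incidence \<open>e0 f0\<close> at a
  non-cut vertex of \<open>A\<close> can be deleted without losing connectedness. Orienting everything else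
  towards \<open>e0\<close> and letting \<open>e0\<close> choose \<open>f0\<close> gives a choice of neighbours that is never mutual.\<close>

lemma non_mutual_selection:
  assumes V: "finite V" "card V \<ge> 2"
    and A: "\<And>e. e \<in> A \<Longrightarrow> e \<subseteq> V \<and> card e = 2" "V \<times> V \<subseteq> conn A"
    and B: "\<And>e. e \<in> B \<Longrightarrow> e \<subseteq> V \<and> card e = 2" "V \<times> V \<subseteq> conn B"
    and AB: "A \<inter> B = {}"
  shows "\<exists>\<phi>. (\<forall>e\<in>A. \<phi> e \<in> B \<and> e \<inter> \<phi> e \<noteq> {}) \<and> (\<forall>e\<in>B. \<phi> e \<in> A \<and> e \<inter> \<phi> e \<noteq> {}) \<and>
    (\<forall>e\<in>A \<union> B. \<phi> (\<phi> e) \<noteq> e)"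
proof -
  obtain v where v: "v \<in> V"
    and v_conn: "\<And>x y. x \<in> V - {v} \<Longrightarrow> y \<in> V - {v} \<Longrightarrow> (x, y) \<in> conn {a \<in> A. v \<notin> a}"
    using non_cut_vertex[OF V A] by blast
  obtain e0 where e0: "e0 \<in> A" "v \<in> e0" using conn_incident_edge[OF V(2) A(2) v] by blast
  obtain f0 where f0: "f0 \<in> B" "v \<in> f0" using conn_incident_edge[OF V(2) B(2) v] by blast
  define r where "r = {(e, f). (e \<in> A \<and> f \<in> B \<or> e \<in> B \<and> f \<in> A) \<and> e \<inter> f \<noteq> {} \<and> {e, f} \<noteq> {e0, f0}}"
  have ef0: "e0 \<noteq> f0" using e0 f0 AB by blast
  \<comment> \<open>Two distinct edges share at most one vertex, so every incidence at a vertex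
    other than \<open>v\<close> survives the deletion of \<open>{e0, f0}\<close>.\<close>
  have only_v: "x = v" if "x \<in> e0" "x \<in> f0" for x
  proof (rule ccontr)
    assume "x \<noteq> v"
    have "e0 = {x, v}"
      using card_2_eq_doubleton[of e0 x v] that(1) e0 A(1)[OF e0(1)] \<open>x \<noteq> v\<close> by blast
    moreover have "f0 = {x, v}"
      using card_2_eq_doubleton[of f0 x v] that(2) f0 B(1)[OF f0(1)] \<open>x \<noteq> v\<close> by blast
    ultimately show False using ef0 by simp
  qed
  have rAB: "(g, h) \<in> r \<and> (h, g) \<in> r" if "g \<in> A" "h \<in> B" "x \<in> g" "x \<in> h" "x \<noteq> v" for g h x
  proof -
    have "{g, h} \<noteq> {e0, f0}" using that only_v[of x] by (auto simp: doubleton_eq_iff)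
    moreover from this have "{h, g} \<noteq> {e0, f0}" by (simp add: insert_commute)
    moreover have "g \<inter> h \<noteq> {}" "h \<inter> g \<noteq> {}" using that by auto
    ultimately show ?thesis using that(1,2) unfolding r_def by simp
  qed
  \<comment> \<open>The edges of \<open>A\<close> and of \<open>B\<close> at \<open>x\<close> form a
    complete bipartite graph with both sides nonempty.\<close>
  have star: "(g, h) \<in> r\<^sup>*"
    if x: "x \<in> V - {v}" and gh: "g \<in> A \<union> B" "h \<in> A \<union> B" "x \<in> g" "x \<in> h" for x g h
  proof -
    have "x \<in> V" "x \<noteq> v" using x by auto
    obtain a where a: "a \<in> A" "x \<in> a" using conn_incident_edge[OF V(2) A(2) \<open>x \<in> V\<close>] by blast
    obtain b where b: "b \<in> B" "x \<in> b" using conn_incident_edge[OF V(2) B(2) \<open>x \<in> V\<close>] by blast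
    have *: "(g, a) \<in> r\<^sup>* \<and> (a, g) \<in> r\<^sup>*" if "g \<in> A \<union> B" "x \<in> g" for g
    proof (cases "g \<in> A")
      case True
      then have "(g, b) \<in> r" "(b, g) \<in> r" "(a, b) \<in> r" "(b, a) \<in> r"
        using rAB a b that \<open>x \<noteq> v\<close> by blast+
      then show ?thesis by (meson r_into_rtrancl rtrancl_trans)
    next
      case False
      then have "(g, a) \<in> r" "(a, g) \<in> r" using rAB a that \<open>x \<noteq> v\<close> by blast+
      then show ?thesis by blast
    qed
    show ?thesis using *[of g] *[of h] gh by (meson rtrancl_trans)
  qed
  \<comment> \<open>As every edge has an end other than \<open>v\<close>, connectedness of
    \<open>A\<close> away from \<open>v\<close> suffices to reach \<open>e0\<close> from
    everywhere.\<close>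
  have other_end: "\<exists>x\<in>V - {v}. x \<in> g" if g: "g \<in> A \<union> B" for g
  proof -
    have "g \<subseteq> V" "card g = 2" using g A(1) B(1) by auto
    moreover have "\<not> g \<subseteq> {v}" using \<open>card g = 2\<close> card_mono[of "{v}" g] by auto
    ultimately show ?thesis by blast
  qed
  have to_e0: "(g, e0) \<in> r\<^sup>*" if g: "g \<in> A \<union> B" for g
  proof -
    obtain x where x: "x \<in> V - {v}" "x \<in> g" using other_end g by blast
    obtain y where y: "y \<in> V - {v}" "y \<in> e0" using other_end e0 by blast
    show ?thesis
    proof (rule incident_edges_connected[where W = "V - {v}" and C = "A \<union> B"
          and A = "{a \<in> A. v \<notin> a}" and x = x and y = y])
      show "(x, y) \<in> conn {a \<in> A. v \<notin> a}" using v_conn x y by blast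
      show "a \<subseteq> V - {v}" if "a \<in> {a \<in> A. v \<notin> a}" for a using that A(1)[of a] by auto
    qed (use x y g e0 star in auto)
  qed
  obtain par and rank :: "'a set \<Rightarrow> nat" where
    par: "\<And>g. g \<in> A \<union> B \<Longrightarrow> g \<noteq> e0 \<Longrightarrow> (g, par g) \<in> r \<and> rank (par g) < rank g"
    using parent_function[OF to_e0] by blast
  define \<phi> where "\<phi> = par(e0 := f0)"
  have rD: "(e \<in> A \<longrightarrow> f \<in> B) \<and> (e \<in> B \<longrightarrow> f \<in> A) \<and> e \<inter> f \<noteq> {} \<and> f \<in> A \<union> B \<and> {e, f} \<noteq> {e0, f0}"
    if "(e, f) \<in> r" for e f
    using that AB unfolding r_def by blast
  have choice: "(g \<in> A \<longrightarrow> \<phi> g \<in> B) \<and> (g \<in> B \<longrightarrow> \<phi> g \<in> A) \<and> g \<inter> \<phi> g \<noteq> {}" if "g \<in> A \<union> B" for g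
  proof (cases "g = e0")
    case True
    then show ?thesis using e0 f0 AB unfolding \<phi>_def by auto
  next
    case False
    then show ?thesis using rD[of g "par g"] par[OF that] unfolding \<phi>_def by simp
  qed
  \<comment> \<open>Away from \<open>e0\<close> ranks strictly fall, so no choice is mutual. The
    pair \<open>e0\<close>, \<open>f0\<close> is safe because its incidence is missing from
    \<open>r\<close>, so the parent of \<open>f0\<close> is not \<open>e0\<close>.\<close>
  moreover have "\<phi> (\<phi> g) \<noteq> g" if g: "g \<in> A \<union> B" for g
  proof (cases "g = e0")
    case True
    have "(f0, par f0) \<in> r" using par[of f0] f0 ef0 by blast
    then have "par f0 \<noteq> e0" using rD[of f0 "par f0"] by (auto simp: insert_commute)
    then show ?thesis using True ef0 unfolding \<phi>_def by simp
  next
    case False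
    have 1: "(g, par g) \<in> r" "rank (par g) < rank g" using par[OF g False] by auto
    show ?thesis
    proof (cases "par g = e0")
      case True
      then have "g \<noteq> f0" using 1 rD[of g "par g"] by (auto simp: insert_commute)
      then show ?thesis using True False unfolding \<phi>_def by simp
    next
      case False
      then have "rank (par (par g)) < rank (par g)" using par[of "par g"] rD[OF 1(1)] by blast
      then have "par (par g) \<noteq> g" using 1(2) by (metis less_asym)
      then show ?thesis using \<open>g \<noteq> e0\<close> False unfolding \<phi>_def by simp
    qed
  qed
  ultimately show ?thesis by (intro exI[of _ \<phi>]) blast
qed

text \<open>Yields a spanning tree of the subgraph of the line graph induced by \<open>A\<close>,
  which is connected because \<open>A\<close> connects all vertices.\<close>

lemma class_parent_function:
  assumes V: "card V \<ge> 2" and A: "\<And>e. e \<in> A \<Longrightarrow> e \<subseteq> V \<and> card e = 2" "V \<times> V \<subseteq> conn A"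
  shows "\<exists>z par (rank :: 'a set \<Rightarrow> nat). z \<in> A \<and> (\<forall>e\<in>A. e \<noteq> z \<longrightarrow>
    par e \<in> A \<and> e \<inter> par e \<noteq> {} \<and> rank (par e) < rank e)"
proof -
  have "V \<noteq> {}" using V by auto
  then obtain v z where v: "v \<in> V" and z: "z \<in> A" "v \<in> z" using conn_incident_edge[OF V A(2)] by blast
  let ?r = "{(e, f). e \<in> A \<and> f \<in> A \<and> e \<inter> f \<noteq> {}}"
  have "(e, z) \<in> ?r\<^sup>*" if e: "e \<in> A" for e
  proof -
    obtain x where x: "x \<in> e" using A(1)[OF e] by fastforce
    show ?thesis
    proof (rule incident_edges_connected[where W = V and C = A and A = A and x = x and y = v])
      show "(x, v) \<in> conn A" using A e x v by blast
      show "(g, h) \<in> ?r\<^sup>*" if "g \<in> A" "h \<in> A" "u \<in> g" "u \<in> h" for u g h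
        using that by (intro r_into_rtrancl) auto
    qed (use A e x z in auto)
  qed
  then obtain par and rank :: "'a set \<Rightarrow> nat" where
    "\<And>e. e \<in> A \<Longrightarrow> e \<noteq> z \<Longrightarrow> (e, par e) \<in> ?r \<and> rank (par e) < rank e"
    using parent_function[of A z ?r] by blast
  then show ?thesis using z by (intro exI[of _ z] exI[of _ par] exI[of _ rank]) auto
qed

text \<open>Only elements of \<open>F i\<close> are inner vertices of the \<open>i\<close>-th tree,
  so disjointness of the classes makes paths internally disjoint. Non-mutual selection makes the
  trees edge-disjoint.\<close>

theorem line_graph_CIST:
  fixes G :: "'a graph" and F :: "nat \<Rightarrow> 'a set set"
  assumes G: "simple_graph G" "card (verts G) \<ge> 2"
    and F: "\<And>i. i < k \<Longrightarrow> F i \<subseteq> edges G" "\<And>i. i < k \<Longrightarrow> verts G \<times> verts G \<subseteq> conn (F i)"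
      "\<And>i j e. i < k \<Longrightarrow> j < k \<Longrightarrow> e \<in> F i \<Longrightarrow> e \<in> F j \<Longrightarrow> i = j"
    and cover: "\<And>e. e \<in> edges G \<Longrightarrow> \<exists>i<k. e \<in> F i"
  shows "\<exists>T. completely_independent_spanning_trees (line_graph G) k T"
proof -
  let ?V = "verts G" and ?E = "edges G"
  have V: "finite ?V" and E: "\<And>e. e \<in> ?E \<Longrightarrow> e \<subseteq> ?V \<and> card e = 2"
    using G by (auto simp: simple_graph_def)
  have FV: "e \<subseteq> ?V \<and> card e = 2" if "i < k" "e \<in> F i" for i e using E F(1) that by blast
  have "\<exists>\<phi>. (\<forall>e\<in>F i. \<phi> e \<in> F j \<and> e \<inter> \<phi> e \<noteq> {}) \<and> (\<forall>e\<in>F j. \<phi> e \<in> F i \<and> e \<inter> \<phi> e \<noteq> {}) \<and>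
    (\<forall>e\<in>F i \<union> F j. \<phi> (\<phi> e) \<noteq> e)" if ij: "i < k" "j < k" "i < j" for i j
  proof (rule non_mutual_selection[OF V G(2)])
    show "F i \<inter> F j = {}" using F(3) ij by blast
  qed (use FV F ij in blast)+
  then obtain sel where sel: "\<And>i j. i < k \<Longrightarrow> j < k \<Longrightarrow> i < j \<Longrightarrow>
    (\<forall>e\<in>F i. sel i j e \<in> F j \<and> e \<inter> sel i j e \<noteq> {}) \<and> (\<forall>e\<in>F j. sel i j e \<in> F i \<and> e \<inter> sel i j e \<noteq> {}) \<and>
    (\<forall>e\<in>F i \<union> F j. sel i j (sel i j e) \<noteq> e)"
    by metis
  \<comment> \<open>One selection per unordered pair of classes serves both directions; otherwise
    \<open>s i j\<close> and \<open>s j i\<close> could choose mutually.\<close>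
  define s where "s i j = sel (min i j) (max i j)" for i j
  have s_comm: "s i j = s j i" for i j by (simp add: s_def min.commute max.commute)
  have s: "s i j e \<in> F i" "e \<inter> s i j e \<noteq> {}" "s i j (s i j e) \<noteq> e"
    if "i < k" "j < k" "i \<noteq> j" "e \<in> F j" for i j e
    using sel[of i j] sel[of j i] that by (cases "i < j"; auto simp: s_def min_def max_def)+
  have "\<forall>i. \<exists>z par (rank :: 'a set \<Rightarrow> nat). i < k \<longrightarrow> z \<in> F i \<and> (\<forall>e\<in>F i. e \<noteq> z \<longrightarrow>
    par e \<in> F i \<and> e \<inter> par e \<noteq> {} \<and> rank (par e) < rank e)"
    using class_parent_function[OF G(2)] FV F(2) by (metis (no_types, lifting))
  then obtain z lp and rk :: "nat \<Rightarrow> 'a set \<Rightarrow> nat" where z: "\<And>i. i < k \<Longrightarrow> z i \<in> F i"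
    and lp: "\<And>i e. i < k \<Longrightarrow> e \<in> F i \<Longrightarrow> e \<noteq> z i \<Longrightarrow>
      lp i e \<in> F i \<and> e \<inter> lp i e \<noteq> {} \<and> rk i (lp i e) < rk i e"
    by metis
  obtain idx where idx: "\<And>e. e \<in> ?E \<Longrightarrow> idx e < k \<and> e \<in> F (idx e)" using cover by metis
  define par where "par i e = (if e \<in> F i then lp i e else s i (idx e) e)" for i e
  \<comment> \<open>A leaf outside \<open>F i\<close> hangs on an element of \<open>F i\<close> and
    gets a rank one higher.\<close>
  define rank where "rank i e = (if e \<in> F i then rk i e else Suc (rk i (par i e)))" for i e
  have par: "par i e \<in> F i \<and> e \<inter> par i e \<noteq> {} \<and> rank i (par i e) < rank i e"
    if "i < k" "e \<in> ?E" "e \<noteq> z i" for i e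
  proof (cases "e \<in> F i")
    case True
    then show ?thesis using lp that by (auto simp: par_def rank_def)
  next
    case False
    then have "i \<noteq> idx e" using idx that by auto
    then have "s i (idx e) e \<in> F i" "e \<inter> s i (idx e) e \<noteq> {}" using s idx that by auto
    then show ?thesis using False by (auto simp: par_def rank_def)
  qed
  define T where "T i = parent_graph ?E (z i) (par i)" for i
  have verts_T: "verts (T i) = ?E" for i by (simp add: T_def parent_graph_def)
  have edges_T: "edges (T i) = {{e, par i e} | e. e \<in> ?E \<and> e \<noteq> z i}" for i
    by (simp add: T_def parent_graph_def)
  have tree: "spanning_tree (T i) (line_graph G)" if i: "i < k" for i
    unfolding spanning_tree_def
  proof (intro conjI)
    show "verts (T i) = verts (line_graph G)" by (simp add: verts_T line_graph_def)
    show "edges (T i) \<subseteq> edges (line_graph G)"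
    proof
      fix x assume "x \<in> edges (T i)"
      then obtain e where e: "x = {e, par i e}" "e \<in> ?E" "e \<noteq> z i" unfolding edges_T by blast
      then have "par i e \<in> ?E" "e \<inter> par i e \<noteq> {}" "e \<noteq> par i e"
        using par[OF i] F(1)[OF i] by (blast, blast, metis less_irrefl)
      then show "x \<in> edges (line_graph G)" using e unfolding line_graph_def by auto
    qed
    show "graph_connected (T i)" unfolding T_def
      by (rule parent_graph_connected[where rank = "rank i"]) (use z i F par in blast)+
    show "acyclic_graph (T i)" unfolding T_def
      by (rule parent_graph_acyclic[where rank = "rank i"]) (use i par in blast)
  qed
  have interior: "x \<in> F i" if i: "i < k" and x: "is_path (T i) u p v" "x \<in> set p" "x \<noteq> u" "x \<noteq> v" for i u p v x
  proof (rule ccontr)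
    assume nx: "x \<notin> F i"
    \<comment> \<open>Parents lie in \<open>F i\<close>, so an element outside \<open>F i\<close> is
      never a parent and is adjacent only to its own.\<close>
    have leaf: "y = par i x" if "{x, y} \<in> edges (T i)" for y
      using that nx par[OF i] unfolding edges_T by (auto simp: doubleton_eq_iff)
    obtain a b where "a \<noteq> b" "{x, a} \<in> edges (T i)" "{x, b} \<in> edges (T i)"
      using is_path_interior[OF x] by blast
    then show False using leaf by blast
  qed
  \<comment> \<open>In a common edge the two parents lie in different classes, so each end is the
    parent of the other. Both ends are then attached as leaves by the same selection and choose each
    other.\<close>
  have disjoint: "edges (T i) \<inter> edges (T j) = {}" if ij: "i < k" "j < k" "i \<noteq> j" for i j
  proof (rule ccontr)
    assume "edges (T i) \<inter> edges (T j) \<noteq> {}"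
    then obtain x where "x \<in> edges (T i)" "x \<in> edges (T j)" by blast
    then obtain e f where e: "e \<in> ?E" "e \<noteq> z i" and f: "f \<in> ?E" "f \<noteq> z j"
      and eq: "{e, par i e} = {f, par j f}" unfolding edges_T by auto
    have pe: "par i e \<in> F i" and pf: "par j f \<in> F j" using par ij e f by auto
    then have "par i e \<noteq> par j f" using F(3) ij by metis
    then have ef: "e = par j f" "f = par i e" using eq by (auto simp: doubleton_eq_iff)
    have eF: "e \<in> F j" and fF: "f \<in> F i" using pe pf ef by metis+
    have "e \<notin> F i" "f \<notin> F j" using F(3)[of i j] ij eF fF by blast+
    moreover have "idx e = j" "idx f = i"
      using idx e(1) f(1) F(3)[of "idx e" j e] F(3)[of "idx f" i f] ij eF fF by blast+
    ultimately have "par i e = s i j e" "par j f = s j i f" by (auto simp: par_def)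
    then have "s i j (s i j e) = e" using ef s_comm[of i j] by metis
    then show False using s(3) ij eF by blast
  qed
  have "completely_independent_spanning_trees (line_graph G) k T"
    unfolding completely_independent_spanning_trees_def
  proof (intro conjI allI impI ballI)
    fix i assume "i < k" then show "spanning_tree (T i) (line_graph G)" by (rule tree)
  next
    fix u v i j p q
    assume ij: "i < k" "j < k" "i \<noteq> j" and p: "is_path (T i) u p v" and q: "is_path (T j) u q v"
    show "path_edges p \<inter> path_edges q = {}"
      using p q disjoint[OF ij] unfolding is_path_def by blast
    have "x = u \<or> x = v" if "x \<in> set p" "x \<in> set q" for x
      using interior[OF ij(1) p] interior[OF ij(2) q] that F(3) ij by metis
    moreover have "{u, v} \<subseteq> set p" "{u, v} \<subseteq> set q"
      using p q hd_in_set last_in_set unfolding is_path_def by (metis empty_subsetI insert_subset)+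
    ultimately show "set p \<inter> set q = {u, v}" by blast
  qed
  then show ?thesis by blast
qed

section \<open>The partition condition\<close>

definition edge_boundary :: "'a graph \<Rightarrow> 'a set \<Rightarrow> 'a set set" where
  "edge_boundary G P = {e \<in> edges G. e \<inter> P \<noteq> {} \<and> \<not> e \<subseteq> P}"

section \<open>Vertex cuts of the line graph\<close>

lemma connectivity_le:
  assumes "S \<subseteq> verts H" "\<not> graph_connected (delete_verts H S) \<or> card (verts H - S) \<le> 1"
  shows "connectivity H \<le> card S"
  unfolding connectivity_def by (rule Least_le) (use assms in blast)

lemma not_graph_connected:
  assumes "e \<in> X" "e \<in> verts H" "f \<in> verts H" "f \<notin> X"
    and closed: "\<And>x y. x \<in> X \<Longrightarrow> {x, y} \<in> edges H \<Longrightarrow> y \<in> X"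
  shows "\<not> graph_connected H"
proof
  assume "graph_connected H"
  then obtain p where p: "is_path H e p f" using assms unfolding graph_connected_def by blast
  have "p ! i \<in> X" if "i < length p" for i
    using that
  proof (induction i)
    case 0
    then show ?case using p assms(1) by (auto simp: is_path_def hd_conv_nth)
  next
    case (Suc i)
    then have "{p ! i, p ! Suc i} \<in> edges H" using p unfolding is_path_def path_edges_def by blast
    then show ?case using closed Suc by simp
  qed
  then have "set p \<subseteq> X" by (metis in_set_conv_nth subsetI)
  moreover have "f \<in> set p" using p unfolding is_path_def by (metis last_in_set)
  ultimately show False using assms(4) by blast
qed

lemma edges_delete_line_graph:
  assumes "{x, y} \<in> edges (delete_verts (line_graph G) S)"
  shows "x \<in> edges G - S \<and> y \<in> edges G - S \<and> x \<inter> y \<noteq> {}"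
proof -
  have "{x, y} \<in> edges (line_graph G)" and S: "{x, y} \<inter> S = {}"
    using assms by (simp_all add: delete_verts_def)
  then obtain e f where "{x, y} = {e, f}" "e \<in> edges G" "f \<in> edges G" "e \<inter> f \<noteq> {}"
    unfolding line_graph_def by auto
  then have "x \<in> edges G" "y \<in> edges G" "x \<inter> y \<noteq> {}"
    by (auto simp only: doubleton_eq_iff Int_commute)
  then show ?thesis using S by simp
qed

lemma simple_graph_finite_edges: "simple_graph G \<Longrightarrow> finite (edges G)"
  unfolding simple_graph_def by (rule finite_subset[of _ "Pow (verts G)"]) auto

text \<open>The edge \<open>uv\<close> has at most \<open>d(u) + d(v) - 2\<close> neighbours in the
  line graph. Deleting them isolates it or leaves it as the only vertex, which
  \<open>connectivity\<close> also counts.\<close>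

lemma connectivity_line_graph_le_degree_sum:
  assumes G: "simple_graph G" and e: "{u, v} \<in> edges G" "u \<noteq> v"
  shows "connectivity (line_graph G) + 2 \<le> degree G u + degree G v"
proof -
  let ?e = "{u, v}" and ?D = "\<lambda>x. {f \<in> edges G. x \<in> f}"
  let ?S = "{f \<in> edges G. f \<noteq> ?e \<and> f \<inter> ?e \<noteq> {}}"
  have fin: "finite (edges G)" using G by (rule simple_graph_finite_edges)
  have "?S = (?D u - {?e}) \<union> (?D v - {?e})" by auto
  then have "card ?S \<le> card (?D u - {?e}) + card (?D v - {?e})" by (simp only: card_Un_le)
  moreover have "Suc (card (?D x - {?e})) = degree G x" if "x \<in> ?e" for x
    unfolding degree_def using that e fin by (intro card_Suc_Diff1) auto
  from this[of u] this[of v] have "degree G u = Suc (card (?D u - {?e}))"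
    "degree G v = Suc (card (?D v - {?e}))" by simp_all
  ultimately have "card ?S + 2 \<le> degree G u + degree G v" by linarith
  moreover have "connectivity (line_graph G) \<le> card ?S"
  proof (rule connectivity_le)
    show "?S \<subseteq> verts (line_graph G)" by (auto simp: line_graph_def)
    show "\<not> graph_connected (delete_verts (line_graph G) ?S) \<or> card (verts (line_graph G) - ?S) \<le> 1"
    proof (cases "verts (line_graph G) - ?S \<subseteq> {?e}")
      case True
      then have "card (verts (line_graph G) - ?S) \<le> card {?e}" by (intro card_mono) auto
      then show ?thesis by simp
    next
      case False
      then obtain f where f: "f \<in> verts (line_graph G) - ?S" "f \<notin> {?e}" by blast
      have "\<not> graph_connected (delete_verts (line_graph G) ?S)"
      proof (rule not_graph_connected[of ?e "{?e}" _ f])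
        show "?e \<in> verts (delete_verts (line_graph G) ?S)"
          using e by (simp add: delete_verts_def line_graph_def)
        show "f \<in> verts (delete_verts (line_graph G) ?S)"
          using f by (simp add: delete_verts_def)
        show "y \<in> {?e}" if "x \<in> {?e}" "{x, y} \<in> edges (delete_verts (line_graph G) ?S)" for x y
          using edges_delete_line_graph[OF that(2)] that(1) by blast
      qed (use f in auto)
      then show ?thesis by blast
    qed
  qed
  ultimately show ?thesis by linarith
qed

text \<open>Once the boundary is deleted, an edge inside \<open>P\<close> meets only edges inside
  \<open>P\<close>, so \<open>g\<close> is cut off from \<open>h\<close>.\<close>

lemma connectivity_line_graph_le_edge_boundary:
  assumes "g \<in> edges G" "g \<subseteq> P" "h \<in> edges G" "h \<inter> P = {}" "h \<noteq> {}"
  shows "connectivity (line_graph G) \<le> card (edge_boundary G P)"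
proof (rule connectivity_le)
  show "edge_boundary G P \<subseteq> verts (line_graph G)" by (auto simp: line_graph_def edge_boundary_def)
  have "\<not> graph_connected (delete_verts (line_graph G) (edge_boundary G P))"
  proof (rule not_graph_connected[of g "{e \<in> edges G. e \<subseteq> P}" _ h])
    show "g \<in> verts (delete_verts (line_graph G) (edge_boundary G P))"
      "h \<in> verts (delete_verts (line_graph G) (edge_boundary G P))"
      using assms by (auto simp: delete_verts_def line_graph_def edge_boundary_def)
    show "y \<in> {e \<in> edges G. e \<subseteq> P}"
      if "x \<in> {e \<in> edges G. e \<subseteq> P}" "{x, y} \<in> edges (delete_verts (line_graph G) (edge_boundary G P))" for x y
      using edges_delete_line_graph[OF that(2)] that(1) unfolding edge_boundary_def by blast
  qed (use assms in auto)
  then show "\<not> graph_connected (delete_verts (line_graph G) (edge_boundary G P)) \<or>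
      card (verts (line_graph G) - edge_boundary G P) \<le> 1" by blast
qed

section \<open>Counting the edges between parts\<close>

lemma quotient_conn_eq_class: "P \<in> V // conn R \<Longrightarrow> x \<in> P \<Longrightarrow> P = conn R `` {x}"
  unfolding quotient_def using conn_class_eq_iff[of R] by auto

text \<open>Each part \<open>P\<close> distributes a unit charge evenly over the edges leaving it, so an edge between
  \<open>P\<close> and \<open>Q\<close> receives \<open>1 / |\<partial>P| + 1 / |\<partial>Q| \<le> 1 / k\<close>.\<close>

lemma card_crossing_edges_ge:
  assumes G: "simple_graph G" and R: "R \<subseteq> edges G" and k: "0 < k"
    and pos: "\<And>P. P \<in> verts G // conn R \<Longrightarrow> 0 < card (edge_boundary G P)"
    and pair: "\<And>x y. {x, y} \<in> edges G \<Longrightarrow> (x, y) \<notin> conn R \<Longrightarrow>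
      k * (card (edge_boundary G (conn R `` {x})) + card (edge_boundary G (conn R `` {y})))
        \<le> card (edge_boundary G (conn R `` {x})) * card (edge_boundary G (conn R `` {y}))"
  shows "k * card (verts G // conn R) \<le> card (edges G - edge_span R)"
proof -
  let ?Q = "verts G // conn R" and ?C = "edges G - edge_span R"
  define d where "d P = real (card (edge_boundary G P))" for P
  have finC: "finite ?C" using simple_graph_finite_edges[OF G] by simp
  have finQ: "finite ?Q" using G by (simp add: quotient_def simple_graph_def)
  have E: "e \<subseteq> verts G" "card e = 2" if "e \<in> edges G" for e
    using G that by (auto simp: simple_graph_def)
  have boundary_C: "{e \<in> ?C. e \<in> edge_boundary G P} = edge_boundary G P" if P: "P \<in> ?Q" for P
  proof -
    have "e \<notin> edge_span R" if e: "e \<in> edge_boundary G P" for e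
    proof
      assume span: "e \<in> edge_span R"
      obtain x y where xy: "x \<in> e" "x \<in> P" "y \<in> e" "y \<notin> P" using e unfolding edge_boundary_def by blast
      then have "(x, y) \<in> conn R" using span unfolding edge_span_def by blast
      then show False using quotient_conn_eq_class[OF P xy(2)] xy(4) by auto
    qed
    then show ?thesis unfolding edge_boundary_def by blast
  qed
  have "real (card ?Q) = (\<Sum>P\<in>?Q. \<Sum>e | e \<in> ?C \<and> e \<in> edge_boundary G P. 1 / d P)"
  proof -
    have "(\<Sum>e | e \<in> ?C \<and> e \<in> edge_boundary G P. 1 / d P) = 1" if "P \<in> ?Q" for P
      unfolding boundary_C[OF that] using pos[OF that] by (simp add: d_def)
    then have "(\<Sum>P\<in>?Q. \<Sum>e | e \<in> ?C \<and> e \<in> edge_boundary G P. 1 / d P) = (\<Sum>P\<in>?Q. 1)"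
      by (rule sum.cong[OF HOL.refl])
    then show ?thesis by simp
  qed
  \<comment> \<open>Double counting: a crossing edge lies in the boundary of exactly the two parts
    that contain its ends.\<close>
  also have "\<dots> = (\<Sum>e\<in>?C. \<Sum>P | P \<in> ?Q \<and> e \<in> edge_boundary G P. 1 / d P)"
    by (rule sum.swap_restrict[OF finQ finC])
  also have "\<dots> \<le> (\<Sum>e\<in>?C. 1 / real k)"
  proof (rule sum_mono)
    fix e assume e: "e \<in> ?C"
    then obtain x y where exy: "e = {x, y}" "x \<noteq> y" using E by (metis DiffD1 card_2_iff)
    then have nxy: "(x, y) \<notin> conn R" using e by simp
    let ?x = "conn R `` {x}" and ?y = "conn R `` {y}"
    have xyV: "x \<in> verts G" "y \<in> verts G" using E(1)[of e] e exy by auto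
    then have Q: "?x \<in> ?Q" "?y \<in> ?Q" by (auto simp: quotient_def)
    have ne: "?x \<noteq> ?y" using nxy conn_class_eq_iff by metis
    have "{P. P \<in> ?Q \<and> e \<in> edge_boundary G P} = {?x, ?y}"
    proof (intro equalityI subsetI)
      fix P assume "P \<in> {P. P \<in> ?Q \<and> e \<in> edge_boundary G P}"
      then have "P \<in> ?Q" "x \<in> P \<or> y \<in> P" using exy unfolding edge_boundary_def by auto
      then have "P = ?x \<or> P = ?y"
        using quotient_conn_eq_class[of P _ R x] quotient_conn_eq_class[of P _ R y] by metis
      then show "P \<in> {?x, ?y}" by simp
    next
      fix P assume P: "P \<in> {?x, ?y}"
      have "(y, x) \<notin> conn R" using nxy conn_sym by metis
      then show "P \<in> {P. P \<in> ?Q \<and> e \<in> edge_boundary G P}"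
        using P Q e exy nxy unfolding edge_boundary_def by auto
    qed
    then have "(\<Sum>P | P \<in> ?Q \<and> e \<in> edge_boundary G P. 1 / d P) = 1 / d ?x + 1 / d ?y" using ne by simp
    also have "\<dots> \<le> 1 / real k"
    proof -
      have "k * (card (edge_boundary G ?x) + card (edge_boundary G ?y)) \<le> card (edge_boundary G ?x) * card (edge_boundary G ?y)"
        using pair[of x y] e exy nxy by simp
      then have "real k * (d ?x + d ?y) \<le> d ?x * d ?y"
        unfolding d_def by (metis of_nat_add of_nat_le_iff of_nat_mult)
      moreover have "0 < d ?x" "0 < d ?y" using pos Q by (auto simp: d_def)
      ultimately show ?thesis using k by (simp add: field_simps)
    qed
    finally show "(\<Sum>P | P \<in> ?Q \<and> e \<in> edge_boundary G P. 1 / d P) \<le> 1 / real k" .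
  qed
  also have "\<dots> = real (card ?C) / real k" by simp
  finally have "real k * real (card ?Q) \<le> real (card ?C)" using k by (simp add: field_simps)
  then show ?thesis by (metis of_nat_le_iff of_nat_mult)
qed

text \<open>Every part other than \<open>P\<close> has a representative outside
  \<open>P\<close>.\<close>

lemma card_quotient_le:
  assumes "finite V" "P \<in> V // conn R"
  shows "card (V // conn R) - 1 \<le> card (V - P)"
proof -
  have "V // conn R - {P} \<subseteq> (\<lambda>x. conn R `` {x}) ` (V - P)"
  proof
    fix Q assume Q: "Q \<in> V // conn R - {P}"
    then obtain x where x: "x \<in> V" "Q = conn R `` {x}" by (auto simp: quotient_def)
    have "x \<notin> P" using quotient_conn_eq_class[OF assms(2)] x Q by blast
    then show "Q \<in> (\<lambda>x. conn R `` {x}) ` (V - P)" using x by blast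
  qed
  then have "card (V // conn R - {P}) \<le> card (V - P)"
    using assms(1) by (intro surj_card_le) auto
  then show ?thesis using assms(2) by simp
qed

text \<open>If some part \<open>P\<close> meets every edge, no edge joins two vertices outside
  \<open>P\<close>, so their stars are disjoint and consist of crossing edges. Otherwise every part
  has a large boundary and the charging argument applies, even giving \<open>k\<close> times the
  number of parts.\<close>

lemma line_graph_connectivity_partition_condition:
  assumes G: "simple_graph G" and R: "R \<subseteq> edges G"
    and deg: "\<And>v. v \<in> verts G \<Longrightarrow> \<delta> \<le> degree G v"
    and k: "0 < k" "k < \<delta>" "\<delta> < 2 * k"
    and conn: "\<delta> ^ 2 \<le> (\<delta> - k) * (connectivity (line_graph G) + 2)"
  shows "k * (card (verts G // conn R) - 1) \<le> card (edges G - edge_span R)"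
proof -
  let ?V = "verts G" and ?E = "edges G" and ?N = "connectivity (line_graph G)"
  have finV: "finite ?V" and E: "\<And>e. e \<in> ?E \<Longrightarrow> e \<subseteq> ?V \<and> card e = 2"
    using G by (auto simp: simple_graph_def)
  have finE: "finite ?E" using G by (rule simple_graph_finite_edges)
  show ?thesis
  proof (cases "\<exists>P\<in>?V // conn R. \<forall>e\<in>?E. e \<inter> P \<noteq> {}")
    case True
    then obtain P where P: "P \<in> ?V // conn R" and meet: "\<And>e. e \<in> ?E \<Longrightarrow> e \<inter> P \<noteq> {}" by blast
    let ?D = "\<lambda>v. {e \<in> ?E. v \<in> e}"
    have "k * (card (?V // conn R) - 1) \<le> \<delta> * card (?V - P)"
      using card_quotient_le[OF finV P] R E k by (intro mult_le_mono) auto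
    also have "\<dots> \<le> (\<Sum>v\<in>?V - P. card (?D v))"
      using sum_bounded_below[of "?V - P" \<delta> "\<lambda>v. card (?D v)"] deg by (simp add: degree_def mult.commute)
    also have "\<dots> = card (\<Union>v\<in>?V - P. ?D v)"
    proof (rule card_UN_disjoint[symmetric])
      show "\<forall>v\<in>?V - P. \<forall>w\<in>?V - P. v \<noteq> w \<longrightarrow> ?D v \<inter> ?D w = {}"
      proof (intro ballI impI)
        fix v w assume vw: "v \<in> ?V - P" "w \<in> ?V - P" "v \<noteq> w"
        have "False" if "e \<in> ?E" "v \<in> e" "w \<in> e" for e
        proof -
          have "e = {v, w}" using card_2_eq_doubleton that vw(3) E by metis
          then show False using meet[OF that(1)] vw by auto
        qed
        then show "?D v \<inter> ?D w = {}" by blast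
      qed
    qed (use finV finE in auto)
    also have "\<dots> \<le> card (?E - edge_span R)"
    proof (rule card_mono)
      show "(\<Union>v\<in>?V - P. ?D v) \<subseteq> ?E - edge_span R"
      proof
        fix e assume "e \<in> (\<Union>v\<in>?V - P. ?D v)"
        then obtain v where v: "v \<notin> P" "e \<in> ?E" "v \<in> e" by blast
        obtain w where w: "w \<in> e" "w \<in> P" using meet[OF v(2)] by blast
        have "(w, v) \<notin> conn R" using quotient_conn_eq_class[OF P w(2)] v(1) by auto
        then show "e \<in> ?E - edge_span R" using v w unfolding edge_span_def by blast
      qed
    qed (use finE in simp)
    finally show ?thesis .
  next
    case False
    \<comment> \<open>Otherwise \<delta>^2 \<le> (\<delta> - k)(\<delta> + 1), while \<delta> < 2k
      gives 2(\<delta> - k) \<le> \<delta> - 1; together 2\<delta>^2 \<le> \<delta>^2 - 1.\<close>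
    have N: "\<delta> \<le> ?N"
    proof (rule ccontr)
      assume "\<not> \<delta> \<le> ?N"
      then have "2 * \<delta> ^ 2 \<le> (2 * (\<delta> - k)) * (\<delta> + 1)"
        using conn mult_le_mono2[of "?N + 2" "\<delta> + 1" "\<delta> - k"] by simp
      also have "\<dots> \<le> (\<delta> - 1) * (\<delta> + 1)" using k by (intro mult_le_mono1) auto
      also have "\<dots> < 2 * \<delta> ^ 2" using k by (cases \<delta>) (auto simp: power2_eq_square)
      finally show False by simp
    qed
    have part: "(\<exists>v\<in>?V. P = {v} \<and> card (edge_boundary G P) = degree G v) \<or> ?N \<le> card (edge_boundary G P)"
      if P: "P \<in> ?V // conn R" for P
    proof -
      obtain x where x: "x \<in> ?V" "P = conn R `` {x}" using P by (auto simp: quotient_def)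
      then have xP: "x \<in> P" by simp
      show ?thesis
      proof (cases "P = {x}")
        case True
        have "edge_boundary G {x} = {e \<in> ?E. x \<in> e}"
        proof -
          have "\<not> e \<subseteq> {x}" if "e \<in> ?E" for e using E[OF that] card_mono[of "{x}" e] by auto
          then show ?thesis unfolding edge_boundary_def by blast
        qed
        then show ?thesis using x True by (auto simp: degree_def)
      next
        case False
        \<comment> \<open>A part with two vertices contains an edge of \<open>R\<close>, and in this
          case some edge of \<open>G\<close> avoids the part, so its boundary is a vertex cut of the
          line graph.\<close>
        then obtain y where y: "y \<in> P" "y \<noteq> x" using xP by blast
        then have "(x, y) \<in> {(x, y). \<exists>e\<in>R. x \<in> e \<and> y \<in> e}\<^sup>*" using x by (auto simp: conn_def)
        then obtain g where g: "g \<in> R" "x \<in> g" using y by (auto elim: converse_rtranclE)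
        then have "g \<subseteq> P" using x conn_edge by fastforce
        moreover obtain h where h: "h \<in> ?E" "h \<inter> P = {}"
          using \<open>\<not> (\<exists>P\<in>?V // conn R. \<forall>e\<in>?E. e \<inter> P \<noteq> {})\<close> P by blast
        moreover have "h \<noteq> {}" using E h by fastforce
        ultimately show ?thesis using connectivity_line_graph_le_edge_boundary g R by blast
      qed
    qed
    have lower: "\<delta> \<le> card (edge_boundary G P)" if "P \<in> ?V // conn R" for P
      using part[OF that] deg N by auto
    have "k * card (?V // conn R) \<le> card (?E - edge_span R)"
    proof (rule card_crossing_edges_ge[OF G R k(1)])
      show "0 < card (edge_boundary G P)" if "P \<in> ?V // conn R" for P using lower[OF that] k by simp
    next
      fix x y assume xy: "{x, y} \<in> ?E" "(x, y) \<notin> conn R"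
      let ?x = "conn R `` {x}" and ?y = "conn R `` {y}"
      let ?a = "card (edge_boundary G ?x)" and ?b = "card (edge_boundary G ?y)"
      have V: "x \<in> ?V" "y \<in> ?V" using E[OF xy(1)] by auto
      then have Q: "?x \<in> ?V // conn R" "?y \<in> ?V // conn R" by (auto simp: quotient_def)
      have ne: "x \<noteq> y" using xy(2) by auto
      \<comment> \<open>If one boundary has at least \<open>?N\<close> edges, the other adds at
        least \<delta> \<ge> 2. Otherwise both parts are single vertices and the degree-sum bound
        applies.\<close>
      have sum: "?N + 2 \<le> ?a + ?b"
      proof (cases "?N \<le> ?a \<or> ?N \<le> ?b")
        case True
        then show ?thesis using lower[OF Q(1)] lower[OF Q(2)] k by auto
      next
        case False
        obtain v where v: "?x = {v}" "?a = degree G v" using part[OF Q(1)] False by blast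
        obtain w where w: "?y = {w}" "?b = degree G w" using part[OF Q(2)] False by blast
        have "x \<in> ?x" "y \<in> ?y" by simp_all
        then have "v = x" "w = y" using v w by simp_all
        then show ?thesis using connectivity_line_graph_le_degree_sum[OF G xy(1) ne] v w by simp
      qed
      have "int \<delta> ^ 2 \<le> (int \<delta> - int k) * (int ?a + int ?b)"
      proof -
        have "\<delta> ^ 2 \<le> (\<delta> - k) * (?a + ?b)"
          using conn mult_le_mono2[OF sum, of "\<delta> - k"] by linarith
        then have "int (\<delta> ^ 2) \<le> int ((\<delta> - k) * (?a + ?b))" by (simp only: of_nat_le_iff)
        then show ?thesis using k by (simp add: of_nat_diff)
      qed
      \<comment> \<open>Expanded, ab \<ge> \<delta>(a + b) - \<delta>^2, and \<delta>^2 \<le>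
        (\<delta> - k)(a + b) turns this into ab \<ge> k(a + b). Integers avoid truncated
        subtraction.\<close>
      moreover have "0 \<le> (int ?a - int \<delta>) * (int ?b - int \<delta>)"
        using lower[OF Q(1)] lower[OF Q(2)] by simp
      ultimately have "int k * (int ?a + int ?b) \<le> int ?a * int ?b"
        by (simp add: algebra_simps power2_eq_square)
      then show "k * (?a + ?b) \<le> ?a * ?b" by (metis of_nat_add of_nat_le_iff of_nat_mult)
    qed
    moreover have "k * (card (?V // conn R) - 1) \<le> k * card (?V // conn R)" by simp
    ultimately show ?thesis by linarith
  qed
qed

section \<open>From the connectivity hypothesis to the trees\<close>

theorem theorem14:
  fixes G :: "'a graph" and k :: nat
  assumes "simple_graph G"
    and "k \<ge> 2"
    and "super_edge_connected G"
    and "k < min_degree G" and "min_degree G < 2 * k"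
    and "m_connected
           (\<lceil>real (min_degree G) ^ 2 / (real (min_degree G) - real k)\<rceil> - 2)
           (line_graph G)"
  shows "\<exists>T. completely_independent_spanning_trees (line_graph G) k T"
proof -
  let ?V = "verts G" and ?E = "edges G" and ?N = "connectivity (line_graph G)"
  define \<delta> where "\<delta> = min_degree G"
  have \<delta>: "k < \<delta>" "\<delta> < 2 * k" using assms by (auto simp: \<delta>_def)
  have finV: "finite ?V" and E: "\<And>e. e \<in> ?E \<Longrightarrow> e \<subseteq> ?V \<and> card e = 2"
    using assms(1) by (auto simp: simple_graph_def)
  have neV: "?V \<noteq> {}" using assms(3) by (auto simp: super_edge_connected_def graph_connected_def)
  have deg: "\<delta> \<le> degree G v" if "v \<in> ?V" for v
    using that finV unfolding \<delta>_def min_degree_def by (intro Min_le) auto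
  have cardV: "card ?V \<ge> 2"
  proof -
    obtain v where "v \<in> ?V" using neV by blast
    then have "0 < degree G v" using deg[of v] \<delta> by simp
    then obtain e where "e \<in> ?E" unfolding degree_def by (auto simp: card_gt_0_iff)
    then show ?thesis using E[of e] card_mono[OF finV, of e] by simp
  qed
  \<comment> \<open>The hypothesis without ceiling and division; \<open>k < \<delta>\<close> makes
    the denominator positive and the natural subtraction exact.\<close>
  have "\<delta> ^ 2 \<le> (\<delta> - k) * (?N + 2)"
  proof -
    have "\<lceil>real \<delta> ^ 2 / (real \<delta> - real k)\<rceil> \<le> int ?N + 2"
      using assms(6) by (simp add: m_connected_def \<delta>_def)
    then have "real \<delta> ^ 2 / (real \<delta> - real k) \<le> real ?N + 2" by (simp add: ceiling_le_iff)
    then have "real \<delta> ^ 2 \<le> (real \<delta> - real k) * (real ?N + 2)"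
      using \<delta> by (simp add: field_simps)
    also have "\<dots> = real ((\<delta> - k) * (?N + 2))" using \<delta> by (simp only: of_nat_diff less_imp_le of_nat_mult of_nat_add of_nat_numeral)
    finally have "real (\<delta> ^ 2) \<le> real ((\<delta> - k) * (?N + 2))" by simp
    then show ?thesis by (simp only: of_nat_le_iff)
  qed
  then have cond: "k * (card (?V // conn R) - 1) \<le> card (?E - edge_span R)" if "R \<subseteq> ?E" for R
    using line_graph_connectivity_partition_condition[OF assms(1) that deg] \<delta> assms(2) by simp
  obtain F where F: "\<And>i. i < k \<Longrightarrow> F i \<subseteq> ?E" "\<And>i. i < k \<Longrightarrow> ?V \<times> ?V \<subseteq> conn (F i)"
    "\<And>i j e. i < k \<Longrightarrow> j < k \<Longrightarrow> e \<in> F i \<Longrightarrow> e \<in> F j \<Longrightarrow> i = j"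
    using Nash_Williams_Tutte[OF finV neV E cond] by blast
  \<comment> \<open>All edges left over go into class \<open>0\<close>, so that the classes
    partition the edge set; enlarging a class keeps it connected.\<close>
  define F' where "F' = F(0 := ?E - (\<Union>i\<in>{0<..<k}. F i))"
  have F'0: "F' 0 = ?E - (\<Union>i\<in>{0<..<k}. F i)" and F'i: "\<And>i. i \<noteq> 0 \<Longrightarrow> F' i = F i"
    by (auto simp: F'_def)
  have k0: "0 < k" using assms(2) by simp
  have "F 0 \<subseteq> F' 0"
  proof
    fix e assume e: "e \<in> F 0"
    then have "e \<notin> F i" if "0 < i" "i < k" for i using F(3)[OF k0 that(2) e] that(1) by auto
    then show "e \<in> F' 0" using e F(1)[OF k0] unfolding F'0 by auto
  qed
  show ?thesis
  proof (rule line_graph_CIST[OF assms(1) cardV, where F = F'])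
    show "F' i \<subseteq> ?E" if "i < k" for i using F(1)[OF that] F'0 F'i by (cases "i = 0") auto
    show "?V \<times> ?V \<subseteq> conn (F' i)" if "i < k" for i
      using F(2)[OF that] conn_mono[OF \<open>F 0 \<subseteq> F' 0\<close>] F'i by (cases "i = 0") auto
    show "i = j" if "i < k" "j < k" "e \<in> F' i" "e \<in> F' j" for i j e
      using that F(3)[of i j e] F'0 F'i by (cases "i = 0"; cases "j = 0") auto
    show "\<exists>i<k. e \<in> F' i" if "e \<in> ?E" for e
    proof (cases "\<exists>i\<in>{0<..<k}. e \<in> F i")
      case True
      then show ?thesis using F'i by auto
    next
      case False
      then show ?thesis using that F'0 k0 by auto
    qed
  qed
qed

end
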